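(* Let $d=1$, let $N\ge3$ and $K\ge1$ be integers with $2K<N$, and let $\zeta$ be a real random variable such that every interval $(a,b)$ with $\mathbb{P}(\zeta\in(a,b))>0$ contains a regular interval. Then for the Jante's law process with parameters $N,K,\zeta$, almost surely $\mathcal{X}'(t)\to\phi$ for some (random) $\phi\in[-\infty,+\infty]$.
   Context: Notation: $\operatorname{supp}\zeta=\{x\in\mathbb{R}:\ \mathbb{P}(|\zeta-x|<\varepsilon)>0\ \forall\varepsilon>0\}$. For points $x_1,\dots,x_n\in\mathbb{R}$ let $\mu_n(x_1,\dots,x_n)=\frac1n\sum_{i=1}^n x_i$ and $G_n(x_1,\dots,x_n)=\frac1n\sum_{i=1}^n\sum_{j=1}^{i-1}|x_i-x_j|^2=\sum_{i=1}^n|x_i-\mu_n|^2$. Regular interval: for an interval $(a,b)\subset\mathbb{R}$, $a<b$, and $\delta\in(0,1)$, the $\delta$-truncation of $(a,b)$ is $(a,b)_\delta=\left(a+\frac{\delta}{2}(b-a),\,b-\frac{\delta}{2}(b-a)\right)$. The interval $(a_1,b_1)$ is called regular if there are $\delta,r\in(0,1)$ such that for any $(a_2,b_2)\subseteq(a_1,b_1)$ we have $\mathbb{P}(\zeta\in(a_2,b_2)_\delta\mid\zeta\in(a_2,b_2))\ge r$ (the condition being imposed whenever $\mathbb{P}(\zeta\in(a_2,b_2))>0$, so that the conditional probability is defined). Core: given a configuration (finite multiset) of $N$ points, its core is a subconfiguration of $N-K$ of these points which minimizes $G_{N-K}$ among all subconfigurations of size $N-K$; if there are several minimizers, one of them is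 chosen with equal probability. Jante's law process with parameters $N,K,\zeta$: the initial configuration $\mathcal{X}(0)$ consists of $N$ distinct points of $\operatorname{supp}\zeta$ (arbitrary or random). Let $\zeta_{t;j}$, $t=1,2,\dots$, $j=1,\dots,K$, be i.i.d. with the distribution of $\zeta$, independent of the initial configuration. Given $\mathcal{X}(t)$, let $\mathcal{X}'(t)$ be its core, and set $\mathcal{X}(t+1)=\mathcal{X}'(t)\cup\{\zeta_{t+1;1},\dots,\zeta_{t+1;K}\}$ (points counted with multiplicity). For $\phi\in\mathbb{R}$ we write $\mathcal{X}'(t)\to\phi$ if all the elements of $\mathcal{X}'(t)$ converge to $\phi$ as $t\to\infty$; $\mathcal{X}'(t)\to+\infty$ if $\min\mathcal{X}'(t)\to+\infty$; $\mathcal{X}'(t)\to-\infty$ if $\max\mathcal{X}'(t)\to-\infty$. *)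

theory Defs
  imports "HOL-Probability.Probability"
begin

section \<open>The law of the samples\<close>

definition rv_support :: "'b measure \<Rightarrow> ('b \<Rightarrow> real) \<Rightarrow> real set" where
  "rv_support P \<zeta> = {x. \<forall>\<epsilon>>0. \<P>(\<omega> in P. \<bar>\<zeta> \<omega> - x\<bar> < \<epsilon>) > 0}"

definition truncation :: "real \<Rightarrow> real \<Rightarrow> real \<Rightarrow> real set" where
  "truncation \<delta> a b = {a + \<delta> / 2 * (b - a) <..< b - \<delta> / 2 * (b - a)}"

text \<open>
  The lower bound is only required where the conditional probability is defined; in particular,
  an interval that \<open>\<zeta>\<close> almost surely avoids is regular.
\<close>

definition regular_interval :: "'b measure \<Rightarrow> ('b \<Rightarrow> real) \<Rightarrow> real \<Rightarrow> real \<Rightarrow> bool" where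
  "regular_interval P \<zeta> a\<^sub>1 b\<^sub>1 \<longleftrightarrow> a\<^sub>1 < b\<^sub>1 \<and>
     (\<exists>\<delta>\<in>{0<..<1}. \<exists>r\<in>{0<..<1}. \<forall>a\<^sub>2 b\<^sub>2.
        a\<^sub>2 < b\<^sub>2 \<longrightarrow> {a\<^sub>2<..<b\<^sub>2} \<subseteq> {a\<^sub>1<..<b\<^sub>1} \<longrightarrow> \<P>(\<omega> in P. \<zeta> \<omega> \<in> {a\<^sub>2<..<b\<^sub>2}) > 0 \<longrightarrow>
        \<P>(\<omega> in P. \<zeta> \<omega> \<in> truncation \<delta> a\<^sub>2 b\<^sub>2 \<bar> \<zeta> \<omega> \<in> {a\<^sub>2<..<b\<^sub>2}) \<ge> r)"


section \<open>Configurations and cores\<close>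

definition mean :: "real multiset \<Rightarrow> real" where
  "mean Y = (\<Sum>x\<in>#Y. x) / real (size Y)"

definition energy :: "real multiset \<Rightarrow> real" where
  "energy Y = (\<Sum>x\<in>#Y. \<bar>x - mean Y\<bar>\<^sup>2)"

lemma sum_square_lessThan:
  fixes f :: "nat \<Rightarrow> nat \<Rightarrow> real"
  assumes "\<And>i j. f i j = f j i" "\<And>i. f i i = 0"
  shows "(\<Sum>i<n. \<Sum>j<n. f i j) = 2 * (\<Sum>i<n. \<Sum>j<i. f i j)"
proof (induction n)
  case (Suc n)
  have "(\<Sum>i<Suc n. \<Sum>j<Suc n. f i j) =
      (\<Sum>i<n. \<Sum>j<n. f i j) + (\<Sum>i<n. f i n) + (\<Sum>j<n. f n j)"
    using assms(2) by (simp add: sum.distrib)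
  moreover have "(\<Sum>i<n. f i n) = (\<Sum>j<n. f n j)"
    by (intro sum.cong refl assms(1))
  ultimately show ?case using Suc.IH by simp
qed simp

text \<open>The energy in terms of pairwise distances, for any enumeration of the points.\<close>

lemma energy_mset:
  "energy (mset xs) = (\<Sum>i<length xs. \<Sum>j<i. \<bar>xs ! i - xs ! j\<bar>\<^sup>2) / real (length xs)"
proof (cases "xs = []")
  case True
  then show ?thesis by (simp add: energy_def)
next
  case False
  define n where "n = length xs"
  define S where "S = (\<Sum>i<n. xs ! i)"
  define Q where "Q = (\<Sum>i<n. (xs ! i)\<^sup>2)"
  have n: "real n > 0" using False by (simp add: n_def)
  have S: "sum_list xs = S"
    unfolding S_def n_def by (simp add: sum_list_sum_nth atLeast0LessThan)
  have m: "mean (mset xs) = S / n"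
    unfolding mean_def by (simp add: sum_mset_sum_list S n_def)
  have "energy (mset xs) = sum_list (map (\<lambda>x. (x - S / n)\<^sup>2) xs)"
    unfolding energy_def m by (simp add: sum_mset_sum_list flip: mset_map)
  also have "\<dots> = (\<Sum>i<n. (xs ! i - S / n)\<^sup>2)"
    by (simp add: sum_list_sum_nth atLeast0LessThan n_def)
  also have "\<dots> = (\<Sum>i<n. (xs ! i)\<^sup>2 - 2 * (S / n) * xs ! i + (S / n)\<^sup>2)"
    by (intro sum.cong refl) (simp add: power2_diff)
  also have "\<dots> = Q - 2 * (S / n) * S + n * (S / n)\<^sup>2"
    by (simp add: sum.distrib sum_subtractf Q_def S_def sum_distrib_left)
  also have "\<dots> = Q - S\<^sup>2 / n"
    using n by (simp add: field_simps power2_eq_square)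
  finally have E: "energy (mset xs) = Q - S\<^sup>2 / n" .
  have "2 * (\<Sum>i<n. \<Sum>j<i. (xs ! i - xs ! j)\<^sup>2) = (\<Sum>i<n. \<Sum>j<n. (xs ! i - xs ! j)\<^sup>2)"
    by (intro sum_square_lessThan[symmetric]) (simp_all add: power2_commute)
  also have "\<dots> = (\<Sum>i<n. \<Sum>j<n. (xs ! i)\<^sup>2 + (xs ! j)\<^sup>2 - 2 * xs ! i * xs ! j)"
    by (intro sum.cong refl) (simp add: power2_diff)
  also have "\<dots> = (\<Sum>i<n. n * (xs ! i)\<^sup>2 + Q - 2 * xs ! i * S)"
    by (simp add: sum.distrib sum_subtractf Q_def S_def sum_distrib_left)
  also have "\<dots> = n * Q + n * Q - 2 * S * S"
    by (simp add: sum.distrib sum_subtractf Q_def S_def sum_distrib_left sum_distrib_right mult_ac)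
  finally have "(\<Sum>i<n. \<Sum>j<i. (xs ! i - xs ! j)\<^sup>2) = n * Q - S\<^sup>2"
    unfolding power2_eq_square[of S] by linarith
  with E n show ?thesis
    by (simp add: n_def field_simps)
qed

definition cores :: "nat \<Rightarrow> real multiset \<Rightarrow> real multiset set" where
  "cores n X = {Y. Y \<subseteq># X \<and> size Y = n \<and>
     (\<forall>Y'. Y' \<subseteq># X \<longrightarrow> size Y' = n \<longrightarrow> energy Y \<le> energy Y')}"

definition tends_to :: "(nat \<Rightarrow> real multiset) \<Rightarrow> ereal \<Rightarrow> bool" where
  "tends_to Y \<phi> = (case \<phi> of
      ereal r \<Rightarrow> \<forall>\<epsilon>>0. \<forall>\<^sub>F t in sequentially. \<forall>x\<in>#Y t. \<bar>x - r\<bar> < \<epsilon>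
    | PInfty \<Rightarrow> filterlim (\<lambda>t. Min (set_mset (Y t))) at_top sequentially
    | MInfty \<Rightarrow> filterlim (\<lambda>t. Max (set_mset (Y t))) at_bot sequentially)"


section \<open>The process\<close>

text \<open>
  The usual \<open>\<sigma>\<close>-algebra on finite point configurations, generated by the numbers of points in
  Borel sets.
\<close>

definition config_algebra :: "real multiset measure" where
  "config_algebra = sigma UNIV {{Y. size {#x \<in># Y. x \<in> B#} = k} | B k. B \<in> sets borel}"

text \<open>
  The information contained in the initial configuration \<open>X\<^sub>0\<close>, the cores \<open>C s\<close> with \<open>s < m\<close>, and
  the samples \<open>Z s j\<close> with \<open>1 \<le> s \<le> t\<close>.
\<close>

definition history ::
  "'w measure \<Rightarrow> nat \<Rightarrow> ('w \<Rightarrow> real multiset) \<Rightarrow> (nat \<Rightarrow> 'w \<Rightarrow> real multiset) \<Rightarrow>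
   (nat \<Rightarrow> nat \<Rightarrow> 'w \<Rightarrow> real) \<Rightarrow> nat \<Rightarrow> nat \<Rightarrow> 'w measure" where
  "history M K X\<^sub>0 C Z m t = sigma (space M)
     ({X\<^sub>0 -` A \<inter> space M | A. A \<in> sets config_algebra} \<union>
      {C s -` A \<inter> space M | s A. s < m \<and> A \<in> sets config_algebra} \<union>
      {Z s j -` B \<inter> space M | s j B. s \<in> {1..t} \<and> j \<in> {1..K} \<and> B \<in> sets borel})"

definition noise ::
  "'w measure \<Rightarrow> nat \<Rightarrow> (nat \<Rightarrow> nat \<Rightarrow> 'w \<Rightarrow> real) \<Rightarrow> nat \<Rightarrow> 'w measure" where
  "noise M K Z t = sigma (space M) {Z t j -` B \<inter> space M | j B. j \<in> {1..K} \<and> B \<in> sets borel}"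

text \<open>
  \<open>X t\<close> is the configuration at time \<open>t\<close>, \<open>C t\<close> its core, and \<open>Z t j\<close> the \<open>j\<close>-th point sampled at
  time \<open>t \<ge> 1\<close>. Ties are broken uniformly among the distinct minimizing submultisets, given
  everything that happened before. The samples of time \<open>t + 1\<close> are independent of all that
  happened before, including the choice of the core at time \<open>t\<close>; together with their mutual
  independence this makes the whole family of samples independent of the initial configuration.
\<close>

locale jante_process = prob_space M
  for M :: "'w measure" and P :: "'b measure" and \<zeta> :: "'b \<Rightarrow> real" and N K :: nat
    and X C :: "nat \<Rightarrow> 'w \<Rightarrow> real multiset" and Z :: "nat \<Rightarrow> nat \<Rightarrow> 'w \<Rightarrow> real" +
  assumes initial_measurable: "X 0 \<in> M \<rightarrow>\<^sub>M config_algebra"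
    and initial_distinct: "\<And>\<omega>. \<omega> \<in> space M \<Longrightarrow> size (X 0 \<omega>) = N \<and> card (set_mset (X 0 \<omega>)) = N"
    and initial_support: "\<And>\<omega>. \<omega> \<in> space M \<Longrightarrow> set_mset (X 0 \<omega>) \<subseteq> rv_support P \<zeta>"
    and samples_indep: "indep_vars (\<lambda>_. borel) (\<lambda>(t, j). Z t j) ({1..} \<times> {1..K})"
    and samples_distr: "\<And>t j. t \<ge> 1 \<Longrightarrow> j \<in> {1..K} \<Longrightarrow> distr M borel (Z t j) = distr P borel \<zeta>"
    and core_measurable: "\<And>t. C t \<in> M \<rightarrow>\<^sub>M config_algebra"
    and core_minimizes: "\<And>t \<omega>. \<omega> \<in> space M \<Longrightarrow> C t \<omega> \<in> cores (N - K) (X t \<omega>)"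
    and core_uniform: "\<And>t A. A \<in> sets config_algebra \<Longrightarrow>
          AE \<omega> in M. real_cond_exp M (history M K (X 0) C Z t t) (\<lambda>\<omega>. indicator A (C t \<omega>)) \<omega> =
            measure_pmf.prob (pmf_of_set (cores (N - K) (X t \<omega>))) A"
    and step: "\<And>t \<omega>. \<omega> \<in> space M \<Longrightarrow>
          X (Suc t) \<omega> = C t \<omega> + {#Z (Suc t) j \<omega>. j \<in># mset_set {1..K}#}"
    and samples_indep_history: "\<And>t.
          indep_set (sets (noise M K Z (Suc t))) (sets (history M K (X 0) C Z (Suc t) t))"

end

theory Submission
  imports Defs
begin

text \<open>
  Write \<open>n = N - K\<close> for the size of the core and \<open>G t\<close> for its energy at time \<open>t\<close>. The old core
  competes for being the new one, so \<open>G\<close> never increases; and as \<open>K < n\<close>, two consecutive cores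
  share a point, so that the core moves by at most a multiple of \<open>sqrt (G t)\<close> at time \<open>t\<close>. The
  proof compares the path that the core travels with the loss of \<open>sqrt G\<close>.

  The tool is \<open>summable_weighted_visits\<close>. Suppose that, for all cores in some set \<open>B\<close>, the
  probability of an event \<open>A\<close> about the next samples is at most a constant times the probability that
  these samples reduce the energy by a fixed factor. Then the expected sum of \<open>sqrt (G t)\<close> over the
  times when the core is in \<open>B\<close> and \<open>A\<close> happens is at most a constant times the expected total loss of
  \<open>sqrt G\<close>. That loss telescopes, so the sum is almost surely finite. This is used twice.

  If \<open>B\<close> consists of the cores in a bounded set with energy at least \<open>g\<close>, one sample close to a
  suitable core point reduces the energy by a fixed factor
  (\<open>resampling_near_opposite_point_reduces_energy\<close>). As the core points lie in the support of \<open>\<zeta>\<close>, the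
  probability of such a sample is bounded below on bounded sets, and \<open>A\<close> may be the sure event. Hence
  the core is in \<open>B\<close> only finitely often (\<open>wide_cores_leave_bounded_sets\<close>): a core that visits a
  bounded set infinitely often has \<open>G t \<longlonglongrightarrow> 0\<close>.

  If \<open>B\<close> consists of the cores well inside a regular interval, \<open>A\<close> is the event that the core changes
  (\<open>summable_moves_in_regular_interval\<close>). When the new core \<open>Y\<close> differs from the old one, it contains a
  sample \<open>w\<close> such that \<open>Y\<close> without \<open>w\<close> has energy at most \<open>(1 - \<kappa>) * G t\<close>
  (\<open>changed_core_relies_on_new_point\<close>). With the other points of \<open>Y\<close> fixed, the positions of \<open>w\<close> for
  which the energy of \<open>Y\<close> does not exceed \<open>G t\<close> form an interval, and away from its ends the energy is
  smaller than \<open>G t\<close> by a fixed factor. Regularity says that \<open>w\<close>, given that it falls into this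
  interval, stays away from the ends with probability bounded below. So whenever \<open>K\<close> samples conspire
  to change the core, redrawing only one of them is enough to compare with a substantial reduction.

  Finally suppose that the minimum of the core oscillates between two levels. It visits a bounded
  set infinitely often because its steps are bounded, so its steps tend to 0. Between the levels there
  is a regular interval, and the position clipped to the inner part of that interval has summable
  increments. It converges, which contradicts the oscillation (\<open>cores_converge\<close>). If the minimum
  converges to a real number, then again \<open>G t \<longlonglongrightarrow> 0\<close> and the whole core follows; if it tends to
  \<open>\<plusminus>\<infinity>\<close>, so does the core, whose diameter is bounded.
\<close>


section \<open>Energy of a finite set of points\<close>

lemma sum_mset_image_nonneg:
  fixes f :: "'a \<Rightarrow> real"
  assumes "\<And>x. x \<in># Y \<Longrightarrow> 0 \<le> f x"
  shows "0 \<le> (\<Sum>x\<in>#Y. f x)"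
  using assms by (induction Y) auto

lemma sum_mset_diff_const: "(\<Sum>x\<in>#Y. x - c) = (\<Sum>x\<in>#Y. x) - real (size Y) * (c::real)"
  by (induction Y) (simp_all add: algebra_simps)

text \<open>The parallel axis theorem; most energy computations below reduce to it.\<close>

lemma sum_squares_about_point:
  "(\<Sum>x\<in>#Y. (x - a)\<^sup>2) = energy Y + size Y * (mean Y - a)\<^sup>2"
proof -
  define m where "m = mean Y"
  have z: "(\<Sum>x\<in>#Y. x - m) = 0"
    by (cases "Y = {#}") (simp_all add: sum_mset_diff_const m_def mean_def)
  have "(\<Sum>x\<in>#Y. (x - a)\<^sup>2) = (\<Sum>x\<in>#Y. (x - m)\<^sup>2 + (2 * (m - a) * (x - m) + (m - a)\<^sup>2))"
    by (intro arg_cong[where f = sum_mset] image_mset_cong) (simp add: power2_eq_square algebra_simps)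
  also have "\<dots> = energy Y + 2 * (m - a) * (\<Sum>x\<in>#Y. x - m) + size Y * (m - a)\<^sup>2"
    by (simp add: sum_mset.distrib energy_def m_def sum_mset_distrib_left)
  finally show ?thesis using z by (simp add: m_def)
qed

lemma energy_nonneg: "0 \<le> energy Y"
  unfolding energy_def by (rule sum_mset_image_nonneg) auto

lemma energy_le_sum_squares: "energy Y \<le> (\<Sum>x\<in>#Y. (x - a)\<^sup>2)"
  by (simp add: sum_squares_about_point)

lemma energy_add_mset:
  assumes "Y \<noteq> {#}"
  shows "energy (add_mset y Y) = energy Y + size Y / (size Y + 1) * (y - mean Y)\<^sup>2"
proof -
  define n where "n = real (size Y)"
  have n: "n > 0" using assms by (simp add: n_def nonempty_has_size)
  have m: "mean (add_mset y Y) - mean Y = (y - mean Y) / (n + 1)"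
  proof -
    have "mean (add_mset y Y) = (y + n * mean Y) / (n + 1)"
      using n by (simp add: mean_def n_def add.commute)
    then show ?thesis using n by (simp add: divide_simps) (simp add: algebra_simps)
  qed
  have "energy (add_mset y Y) = (\<Sum>x\<in>#add_mset y Y. (x - mean Y)\<^sup>2) - (n + 1) * ((y - mean Y) / (n + 1))\<^sup>2"
    by (subst sum_squares_about_point) (simp add: m n_def)
  also have "\<dots> = (y - mean Y)\<^sup>2 + energy Y - (n + 1) * ((y - mean Y) / (n + 1))\<^sup>2"
    by (simp add: sum_squares_about_point)
  also have "\<dots> = energy Y + n / (n + 1) * (y - mean Y)\<^sup>2"
  proof -
    have "(n + 1) * (d / (n + 1))\<^sup>2 = d\<^sup>2 / (n + 1)" "d\<^sup>2 - d\<^sup>2 / (n + 1) = n / (n + 1) * d\<^sup>2" for d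
      using n by (simp_all add: power2_eq_square divide_simps) (simp add: algebra_simps)
    from this[of "y - mean Y"] show ?thesis by linarith
  qed
  finally show ?thesis by (simp add: n_def)
qed

text \<open>The exchange moves the mean by \<open>(u - y) / size Y\<close>, which accounts for the last term.\<close>

lemma energy_swap:
  assumes "y \<in># Y"
  shows "energy (add_mset u (Y - {#y#})) =
    energy Y + (u - mean Y)\<^sup>2 - (y - mean Y)\<^sup>2 - (u - y)\<^sup>2 / size Y"
proof -
  define Y' where "Y' = add_mset u (Y - {#y#})"
  obtain V where Y: "Y = add_mset y V" using assms by (metis insert_DiffM)
  define n where "n = real (size Y)"
  have n: "n > 0" by (simp add: n_def Y)
  have n': "real (size Y') = n" by (simp add: n_def Y'_def Y)
  have m: "mean Y' - mean Y = (u - y) / n"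
    using n unfolding mean_def n' by (simp add: Y'_def Y n_def flip: diff_divide_distrib)
  have "energy Y' = (\<Sum>x\<in>#Y'. (x - mean Y)\<^sup>2) - n * ((u - y) / n)\<^sup>2"
    by (subst sum_squares_about_point) (simp add: m n')
  also have "(\<Sum>x\<in>#Y'. (x - mean Y)\<^sup>2) = (\<Sum>x\<in>#Y. (x - mean Y)\<^sup>2) + (u - mean Y)\<^sup>2 - (y - mean Y)\<^sup>2"
    by (simp add: Y Y'_def)
  also have "(\<Sum>x\<in>#Y. (x - mean Y)\<^sup>2) = energy Y" by (simp add: energy_def)
  finally show ?thesis using n
    by (simp add: Y'_def n_def[symmetric] power2_eq_square)
qed

lemma energy_mono:
  assumes "V \<subseteq># Y"
  shows "energy V \<le> energy Y"
proof -
  have "energy V \<le> (\<Sum>x\<in>#V. (x - mean Y)\<^sup>2)" by (rule energy_le_sum_squares)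
  also have "\<dots> \<le> (\<Sum>x\<in>#V. (x - mean Y)\<^sup>2) + (\<Sum>x\<in>#Y - V. (x - mean Y)\<^sup>2)"
    by (simp add: sum_mset_image_nonneg)
  also have "\<dots> = energy Y"
    using arg_cong[OF subset_mset.add_diff_inverse[OF assms], of "\<lambda>Y'. \<Sum>x\<in>#Y'. (x - mean Y)\<^sup>2"]
    by (simp add: energy_def)
  finally show ?thesis .
qed

lemma distance_le_energy:
  assumes "x \<in># Y" "y \<in># Y"
  shows "(x - y)\<^sup>2 \<le> 2 * energy Y"
proof (cases "x = y")
  case False
  obtain V where V: "Y = add_mset x V" using assms by (metis insert_DiffM)
  have "y \<in># V" using assms V False by auto
  then have "{#x, y#} \<subseteq># Y" using V by simp
  then have "energy {#x, y#} \<le> energy Y" by (rule energy_mono)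
  moreover have "energy {#x, y#} = (x - y)\<^sup>2 / 2"
    by (simp add: energy_add_mset power2_commute) (simp add: energy_def mean_def power2_commute)
  ultimately show ?thesis by simp
qed (simp add: energy_nonneg)

text \<open>The constant \<open>3 / 2\<close> is a rational upper bound for \<open>sqrt 2\<close>.\<close>

lemma distance_le_sqrt_energy:
  assumes "x \<in># Y" "y \<in># Y"
  shows "\<bar>x - y\<bar> \<le> 3 / 2 * sqrt (energy Y)"
proof -
  have "\<bar>x - y\<bar>\<^sup>2 \<le> (3 / 2 * sqrt (energy Y))\<^sup>2"
    using distance_le_energy[OF assms] energy_nonneg[of Y] by (simp add: power_mult_distrib power2_eq_square)
  then show ?thesis by (rule power2_le_imp_le) (simp add: energy_nonneg)
qed

lemma mean_distance_le_sqrt_energy: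
  assumes "x \<in># Y"
  shows "\<bar>x - mean Y\<bar> \<le> sqrt (energy Y)"
proof -
  have "(x - mean Y)\<^sup>2 \<le> energy Y"
    using assms unfolding energy_def by (auto dest!: multi_member_split simp: sum_mset_image_nonneg)
  then show ?thesis using real_le_rsqrt[of "\<bar>x - mean Y\<bar>"] by simp
qed


section \<open>Two ways in which samples reduce the energy\<close>

lemma sum_mset_image_le_card:
  fixes f :: "'a \<Rightarrow> real"
  assumes "\<And>x. x \<in># Y \<Longrightarrow> f x \<le> c"
  shows "(\<Sum>x\<in>#Y. f x) \<le> real (size Y) * c"
  using assms by (induction Y) (auto simp: algebra_simps intro: add_mono)

lemma sum_mset_image_ge_card:
  fixes f :: "'a \<Rightarrow> real"
  assumes "\<And>x. x \<in># Y \<Longrightarrow> c \<le> f x"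
  shows "real (size Y) * c \<le> (\<Sum>x\<in>#Y. f x)"
  using assms by (induction Y) (auto simp: algebra_simps intro: add_mono)

lemma sum_deviations_zero: "(\<Sum>x\<in>#Y. x - mean Y) = 0"
  by (cases "Y = {#}") (simp_all add: sum_mset_diff_const mean_def)

text \<open>The Cauchy--Schwarz inequality, which the parallel axis theorem gives for free.\<close>

lemma square_sum_le_size_times_sum_squares:
  fixes m :: real
  shows "(\<Sum>x\<in>#Y. x - m)\<^sup>2 \<le> size Y * (\<Sum>x\<in>#Y. (x - m)\<^sup>2)"
proof -
  have "(\<Sum>x\<in>#Y. x - m) = size Y * (mean Y - m)"
    by (cases "Y = {#}") (simp_all add: sum_mset_diff_const mean_def algebra_simps)
  then have "(\<Sum>x\<in>#Y. x - m)\<^sup>2 = size Y * (size Y * (mean Y - m)\<^sup>2)"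
    by (simp add: power2_eq_square)
  also have "\<dots> \<le> size Y * (\<Sum>x\<in>#Y. (x - m)\<^sup>2)"
    by (intro mult_left_mono) (simp_all add: sum_squares_about_point energy_nonneg)
  finally show ?thesis .
qed

text \<open>
  Take for \<open>y\<close> a point farthest from the mean and for \<open>z\<close> a point on the other side of the mean (or
  at the mean), which exists because the deviations add up to 0. Moving \<open>y\<close> to \<open>z\<close> does not increase
  the squared distance to the old mean, and since \<open>(z - y)\<^sup>2 \<ge> (y - mean x)\<^sup>2 \<ge> energy x / size x\<close> the
  shift of the mean gains at least \<open>energy x / (size x)\<^sup>2\<close>. The tolerance around \<open>z\<close> is chosen to give
  back at most half of this.
\<close>

lemma resampling_near_opposite_point_reduces_energy:
  assumes "x \<noteq> {#}"
  obtains y z where "y \<in># x" "z \<in># x"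
    "\<And>u. \<bar>u - z\<bar> \<le> sqrt (energy x) / (14 * (size x)\<^sup>2) \<Longrightarrow>
       energy (add_mset u (x - {#y#})) \<le> (1 - 1 / (2 * (size x)\<^sup>2)) * energy x"
proof -
  define n where "n = real (size x)"
  define m where "m = mean x"
  define G where "G = energy x"
  define q where "q = sqrt G"
  have n: "n \<ge> 1" using assms by (simp add: n_def Suc_le_eq nonempty_has_size)
  have G: "G \<ge> 0" by (simp add: G_def energy_nonneg)
  then have q: "q \<ge> 0" "q\<^sup>2 = G" by (simp_all add: q_def)
  define A where "A = (\<lambda>v. (v - m)\<^sup>2) ` set_mset x"
  have "Max A \<in> A" using assms by (intro Max_in) (auto simp: A_def)
  then obtain y where y: "y \<in># x" "(y - m)\<^sup>2 = Max A" by (auto simp: A_def)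
  have ymax: "(v - m)\<^sup>2 \<le> (y - m)\<^sup>2" if "v \<in># x" for v
    using that unfolding y(2) by (intro Max_ge) (auto simp: A_def)
  have "G \<le> n * (y - m)\<^sup>2"
    using sum_mset_image_le_card[of x "\<lambda>v. (v - m)\<^sup>2", OF ymax] by (simp add: G_def energy_def m_def n_def)
  then have yG: "G / n \<le> (y - m)\<^sup>2" using n by (simp add: field_simps)
  have "\<exists>z\<in>#x. (z - m) * (y - m) \<le> 0"
  proof (rule ccontr)
    assume "\<not> ?thesis"
    then have pos: "0 < (v - m) * (y - m)" if "v \<in># x" for v using that by force
    have "(\<Sum>v\<in>#x. (v - m) * (y - m)) = 0"
      using sum_deviations_zero[of x] by (simp add: m_def flip: sum_mset_distrib_right)
    moreover obtain V where V: "x = add_mset y V" using y(1) by (metis insert_DiffM)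
    have "0 \<le> (\<Sum>v\<in>#V. (v - m) * (y - m))"
      by (rule sum_mset_image_nonneg) (use pos V in \<open>auto intro: less_imp_le\<close>)
    ultimately show False using pos[OF y(1)] V by simp
  qed
  then obtain z where z: "z \<in># x" "(z - m) * (y - m) \<le> 0" by blast
  have "energy (add_mset u (x - {#y#})) \<le> (1 - 1 / (2 * n\<^sup>2)) * G"
    if u: "\<bar>u - z\<bar> \<le> q / (14 * n\<^sup>2)" for u
  proof -
    \<comment> \<open>Replacing \<open>z\<close> by \<open>u\<close> costs at most \<open>7 * \<tau> * G\<close>, half of the gain \<open>G / n\<^sup>2\<close>.\<close>
    define \<tau> where "\<tau> = 1 / (14 * n\<^sup>2)"
    have n2: "n\<^sup>2 \<ge> 1" using n by (simp add: one_le_power)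
    have \<tau>: "0 < \<tau>" "\<tau> \<le> 1"
      using n n2 by (simp add: \<tau>_def) (simp add: \<tau>_def divide_le_eq_1, use n2 in linarith)
    have u': "\<bar>u - z\<bar> \<le> \<tau> * q" using u by (simp add: \<tau>_def)
    have \<tau>q: "\<tau> * q \<le> q" using \<tau> q mult_right_mono[of \<tau> 1 q] by simp
    have zm: "\<bar>z - m\<bar> \<le> q" and zy: "\<bar>z - y\<bar> \<le> 3 / 2 * q"
      using mean_distance_le_sqrt_energy[OF z(1)] distance_le_sqrt_energy[OF z(1) y(1)]
      by (simp_all add: q_def G_def m_def)
    have 1: "(u - m)\<^sup>2 \<le> (z - m)\<^sup>2 + \<tau> * q * (3 * q)"
    proof -
      have "(u - m)\<^sup>2 - (z - m)\<^sup>2 = (u - z) * ((u - z) + 2 * (z - m))"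
        by (simp add: power2_eq_square algebra_simps)
      also have "\<dots> \<le> \<bar>u - z\<bar> * \<bar>(u - z) + 2 * (z - m)\<bar>" by (simp flip: abs_mult)
      also have "\<dots> \<le> (\<tau> * q) * (3 * q)"
        by (intro mult_mono) (use u' \<tau>q zm q \<tau> in \<open>(linarith | simp)+\<close>)
      finally show ?thesis by simp
    qed
    have 2: "(z - y)\<^sup>2 - \<tau> * q * (4 * q) \<le> (u - y)\<^sup>2"
    proof -
      have "(z - y)\<^sup>2 - (u - y)\<^sup>2 = (z - u) * ((u - z) + 2 * (z - y))"
        by (simp add: power2_eq_square algebra_simps)
      also have "\<dots> \<le> \<bar>z - u\<bar> * \<bar>(u - z) + 2 * (z - y)\<bar>" by (simp flip: abs_mult)
      also have "\<dots> \<le> (\<tau> * q) * (4 * q)"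
        by (intro mult_mono) (use u' \<tau>q zy q \<tau> in \<open>(linarith | simp)+\<close>)
      finally show ?thesis by simp
    qed
    have 3: "(y - m)\<^sup>2 \<le> (z - y)\<^sup>2"
    proof -
      have "(z - y)\<^sup>2 = (z - m)\<^sup>2 - 2 * ((z - m) * (y - m)) + (y - m)\<^sup>2"
        by (simp add: power2_eq_square algebra_simps)
      then show ?thesis using z(2) by (smt (verit) zero_le_power2)
    qed
    have "(G / n - 4 * (\<tau> * G)) / n \<le> (u - y)\<^sup>2 / n"
      using 2 3 yG n q(2) by (intro divide_right_mono) (auto simp: power2_eq_square algebra_simps)
    moreover have "(G / n - 4 * (\<tau> * G)) / n \<ge> G / n\<^sup>2 - 4 * (\<tau> * G)"
    proof -
      have "4 * (\<tau> * G) / n \<le> 4 * (\<tau> * G) / 1" using n \<tau> G by (intro divide_left_mono) auto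
      then show ?thesis by (simp add: diff_divide_distrib power2_eq_square)
    qed
    ultimately have 4: "G / n\<^sup>2 - 4 * (\<tau> * G) \<le> (u - y)\<^sup>2 / n" by linarith
    have 5: "\<tau> * q * (3 * q) = 3 * (\<tau> * G)" using q(2) by (simp add: power2_eq_square)
    have "energy (add_mset u (x - {#y#})) = G + (u - m)\<^sup>2 - (y - m)\<^sup>2 - (u - y)\<^sup>2 / n"
      by (simp add: energy_swap[OF y(1)] G_def m_def n_def)
    also have "\<dots> \<le> G + 7 * (\<tau> * G) - G / n\<^sup>2"
      using 1 4 5 ymax[OF z(1)] by linarith
    also have "\<dots> = (1 - 1 / (2 * n\<^sup>2)) * G"
      using n by (simp add: \<tau>_def field_simps)
    finally show ?thesis .
  qed
  then show thesis
    by (intro that[OF y(1) z(1)]) (simp add: n_def G_def q_def)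
qed

text \<open>
  Let \<open>m\<close> be the mean of \<open>Y\<close>, and suppose that removing any new point from \<open>Y\<close> leaves the energy above
  \<open>(1 - \<kappa>) * energy x\<close>. Then \<open>Y\<close> itself has almost the energy of \<open>x\<close> and its new points are very close
  to \<open>m\<close>. On the other hand, minimality of \<open>Y\<close> forces every rejected point of \<open>x\<close> to be at least as far
  from \<open>m\<close> as all points of \<open>Y\<close>. So \<open>x\<close> arises from \<open>Y\<close> when points near the centre are replaced by
  equally many, but fewer than \<open>size x\<close>, points far from it, and this makes its energy exceed that of
  \<open>Y\<close> by a definite fraction: a contradiction.
\<close>

lemma changed_core_relies_on_new_point:
  assumes Y: "Y \<in> cores (size x) (x + Zs)" and Zs: "size Zs < size x"
    and "Y \<noteq> x" and "energy x > 0"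
  shows "\<exists>w\<in>#Y - x. energy (Y - {#w#}) \<le> (1 - 1 / (20 * real (size x) ^ 4)) * energy x"
proof (rule ccontr)
  define n where "n = real (size x)"
  define G where "G = energy x"
  define E where "E = energy Y"
  define m where "m = mean Y"
  define \<kappa> where "\<kappa> = 1 / (20 * n ^ 4)"
  define R where "R = Y \<inter># x"
  define W where "W = Y - x"
  define S where "S = x - Y"
  define k where "k = real (size W)"
  define Q where "Q V = (\<Sum>v\<in>#V. (v - m)\<^sup>2)" for V
  define L where "L V = (\<Sum>v\<in>#V. v - m)" for V
  assume "\<not> ?thesis"
  then have bad: "(1 - \<kappa>) * G < energy (Y - {#w#})" if "w \<in># W" for w
    using that by (auto simp: \<kappa>_def n_def G_def W_def not_le)
  have Yx: "Y = R + W" and xR: "x = R + S"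
    by (auto simp: multiset_eq_iff R_def W_def S_def)
  have sub: "Y \<subseteq># x + Zs" and szY: "size Y = size x"
    and min: "\<And>Y'. Y' \<subseteq># x + Zs \<Longrightarrow> size Y' = size x \<Longrightarrow> E \<le> energy Y'"
    using Y by (auto simp: cores_def E_def)
  have szS: "real (size S) = k"
    using szY arg_cong[OF Yx, of size] arg_cong[OF xR, of size] by (simp add: k_def)
  have "W \<noteq> {#}"
  proof
    assume "W = {#}"
    then have "S = {#}" using szS by (simp add: k_def)
    with \<open>W = {#}\<close> show False using Yx xR \<open>Y \<noteq> x\<close> by simp
  qed
  then have k1: "k \<ge> 1" by (simp add: k_def Suc_le_eq nonempty_has_size)
  have "W \<subseteq># Zs" using sub by (simp add: W_def subset_eq_diff_conv add.commute)
  then have "size W < size x" using Zs size_mset_mono by fastforce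
  then have kn: "k \<le> n - 1" by (simp add: k_def n_def)
  have n: "n \<ge> 2" using k1 kn by simp
  have G: "G > 0" using assms by (simp add: G_def)
  have "E \<le> G" using min[of x] by (simp add: G_def)
  have QY: "Q Y = E" by (simp add: Q_def E_def energy_def m_def)
  have Wsmall: "(w - m)\<^sup>2 \<le> \<kappa> * G" and Ebig: "(1 - \<kappa>) * G \<le> E" if "w \<in># W" for w
  proof -
    have "w \<in># Y" using that by (auto simp: W_def dest: in_diffD)
    then obtain V where V: "Y = add_mset w V" by (metis insert_DiffM)
    have "energy (Y - {#w#}) \<le> Q (Y - {#w#})" unfolding Q_def by (rule energy_le_sum_squares)
    also have "\<dots> = E - (w - m)\<^sup>2" using QY by (simp add: V Q_def)
    finally have "(1 - \<kappa>) * G < E - (w - m)\<^sup>2" using bad[OF that] by linarith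
    then show "(w - m)\<^sup>2 \<le> \<kappa> * G" "(1 - \<kappa>) * G \<le> E"
      using \<open>E \<le> G\<close> zero_le_power2[of "w - m"] by (simp_all add: algebra_simps, linarith+)
  qed
  have Ebig: "(1 - \<kappa>) * G \<le> E" using Ebig \<open>W \<noteq> {#}\<close> by (metis multiset_nonemptyE)
  \<comment> \<open>Exchanging any point of \<open>Y\<close> for \<open>s\<close> must not reduce the energy.\<close>
  have Sfar: "E / n \<le> (s - m)\<^sup>2" if "s \<in># S" for s
  proof -
    have "(y - m)\<^sup>2 \<le> (s - m)\<^sup>2" if "y \<in># Y" for y
    proof -
      have "count Y s < count x s" using \<open>s \<in># S\<close> by (auto simp: S_def in_diff_count)
      then have "add_mset s Y \<subseteq># x + Zs"
        using mset_subset_eq_count[OF sub] by (auto intro!: mset_subset_eqI simp: Suc_le_eq)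
      then have "add_mset s (Y - {#y#}) \<subseteq># x + Zs"
        by (meson diff_subset_eq_self mset_subset_eq_add_mset_cancel subset_mset.order_trans)
      moreover have "size (add_mset s (Y - {#y#})) = size x"
        using that szY by (metis insert_DiffM size_add_mset)
      ultimately have "E \<le> energy (add_mset s (Y - {#y#}))" by (rule min)
      also have "\<dots> = E + (s - m)\<^sup>2 - (y - m)\<^sup>2 - (s - y)\<^sup>2 / n"
        by (simp add: energy_swap[OF that] E_def m_def n_def szY)
      finally show ?thesis using n by (smt (verit) divide_nonneg_nonneg zero_le_power2)
    qed
    then have "Q Y \<le> real (size Y) * (s - m)\<^sup>2" unfolding Q_def by (rule sum_mset_image_le_card)
    then show ?thesis using n by (simp add: QY szY n_def field_simps)
  qed
  have QS: "k * (E / n) \<le> Q S"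
    unfolding Q_def szS[symmetric] by (rule sum_mset_image_ge_card) (rule Sfar)
  have QW: "Q W \<le> k * (\<kappa> * G)"
    unfolding Q_def k_def by (rule sum_mset_image_le_card) (rule Wsmall)
  have QW0: "0 \<le> Q W" by (simp add: Q_def sum_mset_image_nonneg)
  have LS: "(L S)\<^sup>2 \<le> k * Q S" and LW: "(L W)\<^sup>2 \<le> k * Q W"
    using square_sum_le_size_times_sum_squares[of m S] square_sum_le_size_times_sum_squares[of m W]
    by (simp_all add: L_def Q_def k_def szS)
  have "L Y = 0" by (simp add: L_def m_def sum_deviations_zero)
  then have "L x = L S - L W" by (simp add: Yx xR L_def)
  moreover have "L x = n * (mean x - m)"
    using n by (simp add: L_def sum_mset_diff_const mean_def n_def algebra_simps)
  ultimately have "L S - L W = n * (mean x - m)" by simp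
  then have mx: "n * (mean x - m)\<^sup>2 = (L S - L W)\<^sup>2 / n"
    using n by (simp add: power2_eq_square)
  have "Q x = G + n * (mean x - m)\<^sup>2"
    by (simp add: Q_def G_def n_def sum_squares_about_point)
  moreover have "Q x = E - Q W + Q S"
    using QY by (simp add: Yx xR Q_def)
  ultimately have Geq: "G = E - Q W + Q S - (L S - L W)\<^sup>2 / n" using mx by linarith
  \<comment> \<open>The weight \<open>1 / (2 * n)\<close> in Young's inequality keeps the coefficient of \<open>Q S\<close> below 1, as \<open>k < n\<close>.\<close>
  have "(L S - L W)\<^sup>2 \<le> (1 + 1 / (2 * n)) * (L S)\<^sup>2 + (1 + 2 * n) * (L W)\<^sup>2"
  proof -
    have "0 \<le> (L S + 2 * n * L W)\<^sup>2 / (2 * n)" using n by simp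
    also have "\<dots> = (L S)\<^sup>2 / (2 * n) + 2 * L S * L W + 2 * n * (L W)\<^sup>2"
      using n by (simp add: power2_eq_square field_simps)
    finally show ?thesis by (simp add: power2_eq_square algebra_simps)
  qed
  also have "\<dots> \<le> (1 + 1 / (2 * n)) * (k * Q S) + (1 + 2 * n) * (k * Q W)"
    using n LS LW by (intro add_mono mult_left_mono) auto
  finally have cross: "(L S - L W)\<^sup>2 / n \<le> ((1 + 1 / (2 * n)) * (k * Q S) + (1 + 2 * n) * (k * Q W)) / n"
    using n by (intro divide_right_mono) auto
  have QS0: "0 \<le> Q S" by (simp add: Q_def sum_mset_image_nonneg)
  have c1: "(1 + 1 / (2 * n)) * (k * Q S) / n \<le> (1 - 1 / (2 * n)) * Q S"
  proof -
    have "(1 + 1 / (2 * n)) * k / n \<le> (1 + 1 / (2 * n)) * (n - 1) / n"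
      using n kn by (intro divide_right_mono mult_left_mono) auto
    also have "\<dots> \<le> 1 - 1 / (2 * n)" using n by (simp add: field_simps)
    finally have "(1 + 1 / (2 * n)) * k / n * Q S \<le> (1 - 1 / (2 * n)) * Q S"
      using QS0 by (rule mult_right_mono)
    then show ?thesis by (simp add: mult_ac)
  qed
  have c2: "(1 + 2 * n) * (k * Q W) / n \<le> (1 + 2 * n) * Q W"
  proof -
    have "k * Q W / n \<le> Q W" using kn n mult_right_mono[OF _ QW0, of k n] by (simp add: divide_le_eq mult.commute)
    then have "(1 + 2 * n) * (k * Q W / n) \<le> (1 + 2 * n) * Q W" using n by (intro mult_left_mono) auto
    then show ?thesis by simp
  qed
  have QW': "Q W \<le> n * (\<kappa> * G)"
    using QW kn G n mult_right_mono[of k n "\<kappa> * G"] by (simp add: \<kappa>_def)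
  have QS': "E / n \<le> Q S"
  proof -
    have "E \<ge> 0" by (simp add: E_def energy_nonneg)
    then have "1 * (E / n) \<le> k * (E / n)" using k1 n by (intro mult_right_mono) auto
    then show ?thesis using QS by linarith
  qed
  have a: "E + Q S / (2 * n) - (2 + 2 * n) * Q W \<le> G"
    using Geq cross c1 c2 by (simp add: add_divide_distrib algebra_simps)
  have b: "(2 + 2 * n) * Q W \<le> G / (5 * n\<^sup>2)"
  proof -
    have "(2 + 2 * n) * Q W \<le> (4 * n) * (n * (\<kappa> * G))"
      using QW' QW0 n by (intro mult_mono) auto
    also have "\<dots> = G / (5 * n\<^sup>2)" using n by (simp add: \<kappa>_def power2_eq_square power4_eq_xxxx)
    finally show ?thesis .
  qed
  have c: "E / (2 * n\<^sup>2) \<le> Q S / (2 * n)"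
    using divide_right_mono[OF QS', of "2 * n"] n by (simp add: power2_eq_square mult_ac)
  have \<kappa>: "\<kappa> \<le> 1 / (20 * n\<^sup>2)" "\<kappa> \<le> 1 / 20"
  proof -
    have "n\<^sup>2 \<ge> 1" using n by (simp add: one_le_power)
    then have "n ^ 4 \<ge> n\<^sup>2" "n ^ 4 \<ge> 1" using n by (auto intro: power_increasing one_le_power)
    then show "\<kappa> \<le> 1 / (20 * n\<^sup>2)" "\<kappa> \<le> 1 / 20"
      using n by (auto simp: \<kappa>_def intro!: divide_left_mono)
  qed
  define h where "h = G / n\<^sup>2"
  have h: "h > 0" using G n by (simp add: h_def)
  have "\<kappa> * G \<le> h / 20" using mult_right_mono[OF \<kappa>(1), of G] G by (simp add: h_def)
  moreover have "\<kappa> * G \<le> G / 20" using mult_right_mono[OF \<kappa>(2), of G] G by simp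
  then have "19 / 20 * G \<le> E" using Ebig by (simp add: algebra_simps)
  then have "19 / 40 * h \<le> E / (2 * n\<^sup>2)" using n by (simp add: h_def field_simps)
  ultimately show False using a b c Ebig h by (simp add: h_def algebra_simps)
qed


section \<open>Resampling a single point\<close>

text \<open>
  From here on configurations are families indexed by \<open>J\<close>, so that they can be distributed according to
  product measures.
\<close>

definition energy_on :: "'i set \<Rightarrow> ('i \<Rightarrow> real) \<Rightarrow> real" where
  "energy_on J f = energy (image_mset f (mset_set J))"

lemma energy_on_nonneg: "0 \<le> energy_on J f"
  by (simp add: energy_on_def energy_nonneg)

lemma energy_on_cong: "(\<And>i. i \<in> J \<Longrightarrow> f i = g i) \<Longrightarrow> energy_on J f = energy_on J g"
  unfolding energy_on_def by (cases "finite J") (auto intro!: arg_cong[where f = energy] image_mset_cong)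

lemma borel_measurable_energy_on [measurable (raw)]:
  assumes "\<And>i. i \<in> J \<Longrightarrow> (\<lambda>\<omega>. g i \<omega>) \<in> borel_measurable M"
  shows "(\<lambda>\<omega>. energy_on J (\<lambda>i. g i \<omega>)) \<in> borel_measurable M"
proof -
  have "energy_on J f = (\<Sum>i\<in>J. (f i - (\<Sum>i\<in>J. f i) / card J)\<^sup>2)" for f
    by (simp add: energy_on_def energy_def mean_def sum_unfold_sum_mset multiset.map_comp comp_def)
  then show ?thesis using assms by simp
qed

lemma submultiset_of_image:
  assumes "finite I" "Y \<subseteq># image_mset f (mset_set I)"
  obtains J where "J \<subseteq> I" "Y = image_mset f (mset_set J)"
proof -
  have "\<exists>J\<subseteq>I. Y = image_mset f (mset_set J)"
    using assms
  proof (induction I arbitrary: Y rule: finite_induct)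
    case (insert i I)
    show ?case
    proof (cases "f i \<in># Y")
      case True
      then obtain V where V: "Y = add_mset (f i) V" by (metis insert_DiffM)
      then obtain J where "J \<subseteq> I" "V = image_mset f (mset_set J)"
        using insert by auto
      moreover from this have "i \<notin> J" "finite J" using insert.hyps finite_subset by auto
      ultimately show ?thesis using V by (intro exI[of _ "insert i J"]) auto
    next
      case False
      then have "Y \<subseteq># image_mset f (mset_set I)"
        using insert by (auto simp: subseteq_mset_def not_in_iff split: if_splits) (metis le_zero_eq not_in_iff zero_le)+
      then show ?thesis using insert.IH by blast
    qed
  qed simp
  then show thesis using that by blast
qed

text \<open>
  The indices in \<open>A\<close> carry the old core and those in \<open>B\<close> the samples. Points of the new core \<open>Y\<close> are
  attributed to \<open>A\<close> as far as their multiplicity in the old core allows.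
\<close>

lemma changed_core_relies_on_new_index:
  assumes fin: "finite A" "finite B" and disj: "A \<inter> B = {}" and card: "card B < card A"
    and Y: "Y \<in> cores (card A) (image_mset f (mset_set A) + image_mset f (mset_set B))"
    and ne: "Y \<noteq> image_mset f (mset_set A)" and pos: "energy_on A f > 0"
  obtains J j where "J \<subseteq> A \<union> B" "card J = card A" "j \<in> J \<inter> B"
    "energy_on J f \<le> energy_on A f"
    "energy_on (J - {j}) f \<le> (1 - 1 / (20 * real (card A) ^ 4)) * energy_on A f"
proof -
  define x where "x = image_mset f (mset_set A)"
  have szx: "size x = card A" by (simp add: x_def)
  obtain w where w: "w \<in># Y - x"
    "energy (Y - {#w#}) \<le> (1 - 1 / (20 * real (size x) ^ 4)) * energy x"
    using changed_core_relies_on_new_point[of Y x "image_mset f (mset_set B)"] Y ne pos card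
    by (auto simp: x_def energy_on_def)
  have Y': "Y \<subseteq># x + image_mset f (mset_set B)" "size Y = card A" "energy Y \<le> energy x"
    using Y szx by (auto simp: cores_def x_def)
  have "Y \<inter># x \<subseteq># image_mset f (mset_set A)" by (simp add: x_def)
  then obtain J1 where J1: "J1 \<subseteq> A" "Y \<inter># x = image_mset f (mset_set J1)"
    using submultiset_of_image fin by metis
  have "Y - x \<subseteq># image_mset f (mset_set B)"
    using Y' by (simp add: subset_eq_diff_conv add.commute)
  then obtain J2 where J2: "J2 \<subseteq> B" "Y - x = image_mset f (mset_set J2)"
    using submultiset_of_image fin by metis
  have fin': "finite J1" "finite J2" using J1 J2 fin by (auto dest: finite_subset)
  have "J1 \<inter> J2 = {}" using J1 J2 disj by blast
  have "Y = Y \<inter># x + (Y - x)" by (auto simp: multiset_eq_iff)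
  also have "\<dots> = image_mset f (mset_set (J1 \<union> J2))"
    using fin' \<open>J1 \<inter> J2 = {}\<close> by (simp add: J1 J2 mset_set_Union)
  finally have YJ: "Y = image_mset f (mset_set (J1 \<union> J2))" .
  obtain j where j: "j \<in> J2" "w = f j" using w(1) fin' by (auto simp: J2(2))
  have "mset_set (J1 \<union> J2) = add_mset j (mset_set (J1 \<union> J2 - {j}))"
    using j fin' by (simp add: mset_set.remove)
  then have "Y - {#w#} = image_mset f (mset_set (J1 \<union> J2 - {j}))" by (simp add: YJ j)
  then show thesis
    using w(2) Y' J1(1) J2(1) j fin'
    by (intro that[of "J1 \<union> J2" j]) (auto simp: energy_on_def YJ x_def)
qed

definition mean_on :: "'i set \<Rightarrow> ('i \<Rightarrow> real) \<Rightarrow> real" where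
  "mean_on J f = mean (image_mset f (mset_set J))"

lemma energy_on_fun_upd:
  assumes "finite J" "j \<in> J" "card J \<ge> 2"
  shows "energy_on J (f(j := y)) =
    energy_on (J - {j}) f + (card J - 1) / card J * (y - mean_on (J - {j}) f)\<^sup>2"
proof -
  have ms: "mset_set J = add_mset j (mset_set (J - {j}))"
    using assms by (simp add: mset_set.remove)
  have im: "image_mset (f(j := y)) (mset_set (J - {j})) = image_mset f (mset_set (J - {j}))"
    using assms by (intro image_mset_cong) auto
  have "card (J - {j}) = card J - 1" using assms by simp
  then have "J - {j} \<noteq> {}" using assms by (metis One_nat_def Suc_1 card.empty diff_is_0_eq not_less_eq_eq)
  then have "image_mset f (mset_set (J - {j})) \<noteq> {#}" using assms by (simp add: mset_set_empty_iff)
  from energy_add_mset[OF this, of y] show ?thesis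
    using assms by (simp add: energy_on_def mean_on_def ms im of_nat_diff)
qed

text \<open>
  Regularity speaks about open intervals and \<open>\<nu>\<close> may a priori charge the end points of the closed
  one. It is therefore applied to the interval of radius \<open>(1 + \<delta>) * \<rho>\<close>, whose \<open>\<delta>\<close>-truncation has
  radius \<open>(1 + \<delta>) * (1 - \<delta>) * \<rho>\<close>, still smaller than \<open>\<rho>\<close>.
\<close>

lemma emeasure_symmetric_interval_le_truncation:
  fixes \<nu> :: "real measure" and m \<rho> \<delta> r c d :: real
  assumes \<nu>: "finite_measure \<nu>" "sets \<nu> = sets borel"
    and reg: "\<And>a b. a < b \<Longrightarrow> {a<..<b} \<subseteq> {c<..<d} \<Longrightarrow>
      r * measure \<nu> {a<..<b} \<le> measure \<nu> (truncation \<delta> a b)"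
    and r: "r > 0" and \<delta>: "0 < \<delta>" "\<delta> < 1" and \<rho>: "\<rho> > 0"
    and sub: "c \<le> m - 2 * \<rho>" "m + 2 * \<rho> \<le> d"
  shows "ennreal r * emeasure \<nu> {y. \<bar>y - m\<bar> \<le> \<rho>} \<le> emeasure \<nu> {y. \<bar>y - m\<bar> < (1 - \<delta>\<^sup>2) * \<rho>}"
proof -
  interpret finite_measure \<nu> by fact
  define s where "s = (1 + \<delta>) * \<rho>"
  have s: "s > \<rho>" "s < 2 * \<rho>" using \<delta> \<rho> by (simp_all add: s_def)
  have "r * measure \<nu> {y. \<bar>y - m\<bar> \<le> \<rho>} \<le> r * measure \<nu> {m - s<..<m + s}"
    using r s by (intro mult_left_mono finite_measure_mono) (auto simp: \<nu>)
  also have "\<dots> \<le> measure \<nu> (truncation \<delta> (m - s) (m + s))"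
    using s sub \<rho> by (intro reg) auto
  also have "truncation \<delta> (m - s) (m + s) = {y. \<bar>y - m\<bar> < (1 - \<delta>\<^sup>2) * \<rho>}"
  proof -
    have "m - s + \<delta> / 2 * (m + s - (m - s)) = m - (1 - \<delta>\<^sup>2) * \<rho>"
      "m + s - \<delta> / 2 * (m + s - (m - s)) = m + (1 - \<delta>\<^sup>2) * \<rho>"
      by (simp_all add: s_def power2_eq_square algebra_simps)
    then show ?thesis by (auto simp: truncation_def abs_less_iff)
  qed
  finally show ?thesis using r by (simp add: emeasure_eq_measure ennreal_mult[symmetric])
qed

definition joint :: "'i set \<Rightarrow> ('i \<Rightarrow> real) \<Rightarrow> ('i \<Rightarrow> real) \<Rightarrow> 'i \<Rightarrow> real" where
  "joint B x z i = (if i \<in> B then z i else x i)"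

lemma borel_measurable_energy_on_joint:
  assumes "\<And>i. i \<in> B \<Longrightarrow> (\<lambda>\<omega>. z \<omega> i) \<in> borel_measurable M"
    and "\<And>i. i \<in> J - B \<Longrightarrow> (\<lambda>\<omega>. x \<omega> i) \<in> borel_measurable M"
  shows "(\<lambda>\<omega>. energy_on J (joint B (x \<omega>) (z \<omega>))) \<in> borel_measurable M"
proof (rule borel_measurable_energy_on)
  fix i assume "i \<in> J"
  then show "(\<lambda>\<omega>. joint B (x \<omega>) (z \<omega>) i) \<in> borel_measurable M"
    using assms by (cases "i \<in> B") (simp_all add: joint_def)
qed

text \<open>
  Integrate over the coordinate \<open>j\<close> first. As a function of it, the energy is \<open>b\<close> plus a multiple of the
  squared distance to the mean of the other points, where \<open>b \<le> (1 - \<kappa>) * G\<close> is the energy of the other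
  points. So the energy is at most \<open>G\<close> on an interval, and at most \<open>(1 - \<delta>\<^sup>2 * \<kappa>) * G\<close> when its radius
  shrinks by the factor \<open>1 - \<delta>\<^sup>2\<close>. The point with index \<open>i0\<close>, which is not resampled, keeps the
  enlarged interval within distance \<open>5 * sqrt G\<close> of \<open>x i0\<close> and thereby in \<open>(c, d)\<close>.
\<close>

lemma resampling_one_coordinate:
  fixes \<nu> :: "real measure" and \<kappa> \<delta> r c d G :: real and x :: "'i \<Rightarrow> real"
  assumes \<nu>: "prob_space \<nu>" "sets \<nu> = sets borel"
    and reg: "\<And>a b. a < b \<Longrightarrow> {a<..<b} \<subseteq> {c<..<d} \<Longrightarrow>
      r * measure \<nu> {a<..<b} \<le> measure \<nu> (truncation \<delta> a b)"
    and r: "r > 0" and \<delta>: "0 < \<delta>" "\<delta> < 1" and G: "G > 0" and \<kappa>: "0 < \<kappa>"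
    and fin: "finite B" "finite J" and j: "j \<in> J" "j \<in> B" and J: "card J \<ge> 2"
    and i0: "i0 \<in> J" "i0 \<notin> B"
    and x: "c + 5 * sqrt G < x i0" "x i0 < d - 5 * sqrt G"
  defines "Q \<equiv> PiM B (\<lambda>_. \<nu>)"
  shows "ennreal r * emeasure Q {z \<in> space Q. energy_on J (joint B x z) \<le> G \<and>
             energy_on (J - {j}) (joint B x z) \<le> (1 - \<kappa>) * G} \<le>
         emeasure Q {z \<in> space Q. energy_on J (joint B x z) \<le> (1 - \<delta>\<^sup>2 * \<kappa>) * G}"
proof -
  interpret \<nu>: prob_space \<nu> by fact
  interpret product_sigma_finite "\<lambda>_::'i. \<nu>" by standard
  have [measurable_cong]: "sets \<nu> = sets borel" by fact
  define B' where "B' = B - {j}"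
  have B: "B = insert j B'" "j \<notin> B'" "finite B'" using j fin by (auto simp: B'_def)
  define S where "S = {z \<in> space Q. energy_on J (joint B x z) \<le> G \<and>
             energy_on (J - {j}) (joint B x z) \<le> (1 - \<kappa>) * G}"
  define T where "T = {z \<in> space Q. energy_on J (joint B x z) \<le> (1 - \<delta>\<^sup>2 * \<kappa>) * G}"
  have me [measurable]: "(\<lambda>z. energy_on J' (joint B x z)) \<in> borel_measurable Q" for J'
    unfolding Q_def by (rule borel_measurable_energy_on_joint) measurable
  have [measurable]: "S \<in> sets Q" "T \<in> sets Q" unfolding S_def T_def by measurable
  have ST: "indicator S \<in> borel_measurable (PiM (insert j B') (\<lambda>_. \<nu>))"
    "indicator T \<in> borel_measurable (PiM (insert j B') (\<lambda>_. \<nu>))"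
    by (simp_all flip: Q_def B(1))
  have inner: "ennreal r * (\<integral>\<^sup>+y. indicator S (z(j := y)) \<partial>\<nu>) \<le> (\<integral>\<^sup>+y. indicator T (z(j := y)) \<partial>\<nu>)"
    if z: "z \<in> space (PiM B' (\<lambda>_. \<nu>))" for z
  proof -
    define f where "f = joint B x z"
    define b where "b = energy_on (J - {j}) f"
    define m where "m = mean_on (J - {j}) f"
    define n where "n = real (card J)"
    have n: "n \<ge> 2" using J by (simp add: n_def)
    have sp: "z(j := y) \<in> space Q" for y
      using z sets_eq_imp_space_eq[OF \<nu>(2)] unfolding Q_def B(1)
      by (auto simp: space_PiM PiE_iff extensional_def)
    have up: "joint B x (z(j := y)) = f(j := y)" for y
      using j by (auto simp: joint_def f_def)
    have EJ: "energy_on J (joint B x (z(j := y))) = b + (n - 1) / n * (y - m)\<^sup>2" for y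
      using energy_on_fun_upd[OF fin(2) j(1) J, of f y] J
      by (simp add: up b_def m_def n_def of_nat_diff)
    have Ej: "energy_on (J - {j}) (joint B x (z(j := y))) = b" for y
      unfolding up b_def by (rule energy_on_cong) auto
    have Tint: "(\<integral>\<^sup>+y. indicator T (z(j := y)) \<partial>\<nu>) =
      emeasure \<nu> {y. b + (n - 1) / n * (y - m)\<^sup>2 \<le> (1 - \<delta>\<^sup>2 * \<kappa>) * G}"
      by (subst nn_integral_indicator[symmetric], simp)
        (intro nn_integral_cong, auto simp: T_def sp EJ split: split_indicator)
    show ?thesis
    proof (cases "b \<le> (1 - \<kappa>) * G")
      case False
      then have "indicator S (z(j := y)) = (0::ennreal)" for y by (auto simp: S_def Ej)
      then show ?thesis by simp
    next
      case True
      have b0: "b \<ge> 0" by (simp add: b_def energy_on_nonneg)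
      have Gb: "\<kappa> * G \<le> G - b" using True by (simp add: algebra_simps)
      have Gb0: "0 < G - b" using Gb mult_pos_pos[OF \<kappa> G] by linarith
      define \<rho> where "\<rho> = sqrt (n / (n - 1) * (G - b))"
      have \<rho>0: "\<rho> > 0" using n Gb0 by (simp add: \<rho>_def)
      have \<rho>2: "(n - 1) / n * \<rho>\<^sup>2 = G - b" using n Gb0 by (simp add: \<rho>_def)
      have "n / (n - 1) * (G - b) \<le> 2 * G"
        using n b0 Gb0 by (intro mult_mono) (auto simp: field_simps)
      also have "\<dots> \<le> (3 / 2 * sqrt G)\<^sup>2" using G by (simp add: power_mult_distrib power2_eq_square)
      finally have \<rho>G: "\<rho> \<le> 3 / 2 * sqrt G" unfolding \<rho>_def using G by (intro real_le_lsqrt) auto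
      have Sint: "(\<integral>\<^sup>+y. indicator S (z(j := y)) \<partial>\<nu>) = emeasure \<nu> {y. \<bar>y - m\<bar> \<le> \<rho>}"
      proof -
        have "b + (n - 1) / n * (y - m)\<^sup>2 \<le> G \<longleftrightarrow> \<bar>y - m\<bar> \<le> \<rho>" for y
        proof -
          have "b + (n - 1) / n * (y - m)\<^sup>2 \<le> G \<longleftrightarrow> (n - 1) / n * (y - m)\<^sup>2 \<le> (n - 1) / n * \<rho>\<^sup>2"
            unfolding \<rho>2 by auto
          also have "\<dots> \<longleftrightarrow> (y - m)\<^sup>2 \<le> \<rho>\<^sup>2" using n by (subst mult_le_cancel_left_pos) auto
          also have "\<dots> \<longleftrightarrow> \<bar>y - m\<bar> \<le> \<bar>\<rho>\<bar>" by (rule abs_le_square_iff[symmetric])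
          finally show ?thesis using \<rho>0 by simp
        qed
        then show ?thesis
          by (subst nn_integral_indicator[symmetric], simp)
            (intro nn_integral_cong, auto simp: S_def sp EJ Ej True split: split_indicator)
      qed
      have mG: "\<bar>x i0 - m\<bar> \<le> sqrt G"
      proof -
        have "f i0 \<in># image_mset f (mset_set (J - {j}))" using i0 j fin by auto
        then have "\<bar>f i0 - m\<bar> \<le> sqrt b"
          unfolding m_def b_def mean_on_def energy_on_def by (rule mean_distance_le_sqrt_energy)
        also have "\<dots> \<le> sqrt G" using Gb0 by simp
        finally show ?thesis using i0 by (simp add: f_def joint_def)
      qed
      have "ennreal r * emeasure \<nu> {y. \<bar>y - m\<bar> \<le> \<rho>} \<le>
        emeasure \<nu> {y. \<bar>y - m\<bar> < (1 - \<delta>\<^sup>2) * \<rho>}"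
        using x mG \<rho>G real_sqrt_gt_zero[OF G] \<nu>.finite_measure_axioms \<nu>(2) reg r \<delta> \<rho>0
        by (intro emeasure_symmetric_interval_le_truncation[where c = c and d = d]) auto
      also have "\<dots> \<le> emeasure \<nu> {y. b + (n - 1) / n * (y - m)\<^sup>2 \<le> (1 - \<delta>\<^sup>2 * \<kappa>) * G}"
      proof (rule emeasure_mono)
        show "{y. \<bar>y - m\<bar> < (1 - \<delta>\<^sup>2) * \<rho>} \<subseteq> {y. b + (n - 1) / n * (y - m)\<^sup>2 \<le> (1 - \<delta>\<^sup>2 * \<kappa>) * G}"
        proof safe
          fix y assume y: "\<bar>y - m\<bar> < (1 - \<delta>\<^sup>2) * \<rho>"
          have \<delta>2: "0 < 1 - \<delta>\<^sup>2" "1 - \<delta>\<^sup>2 < 1" using \<delta> by (simp_all add: power_less_one_iff)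
          have "(y - m)\<^sup>2 \<le> ((1 - \<delta>\<^sup>2) * \<rho>)\<^sup>2"
            using y \<delta>2 \<rho>0 by (subst abs_le_square_iff[symmetric]) auto
          also have "\<dots> = (1 - \<delta>\<^sup>2)\<^sup>2 * \<rho>\<^sup>2" by (simp add: power_mult_distrib)
          also have "\<dots> \<le> (1 - \<delta>\<^sup>2) * \<rho>\<^sup>2"
            using \<delta>2 by (intro mult_right_mono) (auto simp: power2_eq_square mult_le_cancel_left1)
          finally have "(n - 1) / n * (y - m)\<^sup>2 \<le> (n - 1) / n * ((1 - \<delta>\<^sup>2) * \<rho>\<^sup>2)"
            using n by (intro mult_left_mono) auto
          also have "\<dots> = (1 - \<delta>\<^sup>2) * (G - b)" by (simp flip: \<rho>2)
          also have "\<dots> = G - b - \<delta>\<^sup>2 * (G - b)" by (simp add: algebra_simps)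
          also have "\<dots> \<le> G - b - \<delta>\<^sup>2 * (\<kappa> * G)" using Gb by (intro diff_left_mono mult_left_mono) auto
          finally show "b + (n - 1) / n * (y - m)\<^sup>2 \<le> (1 - \<delta>\<^sup>2 * \<kappa>) * G" by (simp add: algebra_simps)
        qed
      qed simp
      finally show ?thesis by (simp add: Sint Tint)
    qed
  qed
  have "ennreal r * emeasure Q S = ennreal r * (\<integral>\<^sup>+z. indicator S z \<partial>Q)" by simp
  also have "\<dots> = ennreal r * (\<integral>\<^sup>+z. (\<integral>\<^sup>+y. indicator S (z(j := y)) \<partial>\<nu>) \<partial>PiM B' (\<lambda>_. \<nu>))"
    using product_nn_integral_insert[OF B(3,2) ST(1)] by (simp add: Q_def flip: B(1))
  also have "\<dots> = (\<integral>\<^sup>+z. ennreal r * (\<integral>\<^sup>+y. indicator S (z(j := y)) \<partial>\<nu>) \<partial>PiM B' (\<lambda>_. \<nu>))"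
  proof (rule nn_integral_cmult[symmetric], rule \<nu>.borel_measurable_nn_integral)
    have "(\<lambda>(z, y). z(j := y)) \<in> PiM B' (\<lambda>_. \<nu>) \<Otimes>\<^sub>M \<nu> \<rightarrow>\<^sub>M Q"
      unfolding Q_def B(1) by (rule measurable_add_dim)
    from measurable_compose[OF this borel_measurable_indicator[OF \<open>S \<in> sets Q\<close>]]
    show "(\<lambda>(z, y). indicator S (z(j := y)) :: ennreal) \<in> borel_measurable (PiM B' (\<lambda>_. \<nu>) \<Otimes>\<^sub>M \<nu>)"
      by (simp add: case_prod_unfold)
  qed
  also have "\<dots> \<le> (\<integral>\<^sup>+z. (\<integral>\<^sup>+y. indicator T (z(j := y)) \<partial>\<nu>) \<partial>PiM B' (\<lambda>_. \<nu>))"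
    by (intro nn_integral_mono inner)
  also have "\<dots> = (\<integral>\<^sup>+z. indicator T z \<partial>Q)"
    using product_nn_integral_insert[OF B(3,2) ST(2)] by (simp add: Q_def flip: B(1))
  also have "\<dots> = emeasure Q T" by simp
  finally show ?thesis unfolding S_def T_def .
qed


section \<open>Probability of a reduction of the energy\<close>

text \<open>
  \<open>A\<close> is the index set of the current core, \<open>B\<close> that of the samples. Under \<open>shrinks\<close> the next core has
  at most \<open>1 - \<kappa>\<close> times the current energy; \<open>may_change\<close> (for the right \<open>\<kappa>\<close>) is a necessary condition
  for the next core to be different from the current one.
\<close>

definition shrinks :: "'i set \<Rightarrow> 'i set \<Rightarrow> real \<Rightarrow> ('i \<Rightarrow> real) \<Rightarrow> bool" where
  "shrinks A B \<kappa> f \<longleftrightarrow> (\<exists>J\<in>Pow (A \<union> B). card J = card A \<and> energy_on J f \<le> (1 - \<kappa>) * energy_on A f)"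

definition may_change :: "'i set \<Rightarrow> 'i set \<Rightarrow> real \<Rightarrow> ('i \<Rightarrow> real) \<Rightarrow> bool" where
  "may_change A B \<kappa> f \<longleftrightarrow> (\<exists>(J, j)\<in>Pow (A \<union> B) \<times> B. card J = card A \<and> j \<in> J \<and>
     energy_on J f \<le> energy_on A f \<and> energy_on (J - {j}) f \<le> (1 - \<kappa>) * energy_on A f)"

lemma sets_shrinks:
  assumes fin: "finite A" "finite B"
    and "\<And>J. J \<subseteq> A \<union> B \<Longrightarrow> (\<lambda>\<omega>. energy_on J (g \<omega>)) \<in> borel_measurable M"
  shows "{\<omega> \<in> space M. shrinks A B \<kappa> (g \<omega>)} \<in> sets M"
  unfolding shrinks_def
proof (rule sets.sets_Collect_finite_Ex)
  fix J assume "J \<in> Pow (A \<union> B)"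
  then have J: "J \<subseteq> A \<union> B" by auto
  have [measurable]: "(\<lambda>\<omega>. energy_on J (g \<omega>)) \<in> borel_measurable M"
    "(\<lambda>\<omega>. energy_on A (g \<omega>)) \<in> borel_measurable M"
    by (rule assms(3), use J in blast)+
  show "{\<omega> \<in> space M. card J = card A \<and> energy_on J (g \<omega>) \<le> (1 - \<kappa>) * energy_on A (g \<omega>)} \<in> sets M"
    by measurable
qed (use fin in simp)

lemma sets_may_change_part:
  assumes "\<And>J. J \<subseteq> A \<union> B \<Longrightarrow> (\<lambda>\<omega>. energy_on J (g \<omega>)) \<in> borel_measurable M"
    and "J \<subseteq> A \<union> B"
  shows "{\<omega> \<in> space M. card J = card A \<and> j \<in> J \<and> energy_on J (g \<omega>) \<le> energy_on A (g \<omega>) \<and>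
    energy_on (J - {j}) (g \<omega>) \<le> (1 - \<kappa>) * energy_on A (g \<omega>)} \<in> sets M"
proof -
  have [measurable]: "(\<lambda>\<omega>. energy_on J (g \<omega>)) \<in> borel_measurable M"
    "(\<lambda>\<omega>. energy_on (J - {j}) (g \<omega>)) \<in> borel_measurable M"
    "(\<lambda>\<omega>. energy_on A (g \<omega>)) \<in> borel_measurable M"
    by (rule assms(1), use assms(2) in blast)+
  show ?thesis by measurable
qed

lemma sets_may_change:
  assumes fin: "finite A" "finite B"
    and meas: "\<And>J. J \<subseteq> A \<union> B \<Longrightarrow> (\<lambda>\<omega>. energy_on J (g \<omega>)) \<in> borel_measurable M"
  shows "{\<omega> \<in> space M. may_change A B \<kappa> (g \<omega>)} \<in> sets M"
  unfolding may_change_def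
proof (rule sets.sets_Collect_finite_Ex)
  fix p assume "p \<in> Pow (A \<union> B) \<times> B"
  then obtain J j where p: "p = (J, j)" "J \<subseteq> A \<union> B" by auto
  show "{\<omega> \<in> space M. case p of (J, j) \<Rightarrow> card J = card A \<and> j \<in> J \<and>
     energy_on J (g \<omega>) \<le> energy_on A (g \<omega>) \<and> energy_on (J - {j}) (g \<omega>) \<le> (1 - \<kappa>) * energy_on A (g \<omega>)} \<in> sets M"
    unfolding p prod.case by (rule sets_may_change_part[OF meas p(2)])
qed (use fin in simp)

lemma energy_on_joint_old: "A \<inter> B = {} \<Longrightarrow> energy_on A (joint B x z) = energy_on A x"
  by (rule energy_on_cong) (auto simp: joint_def)

lemma measurable_energy_on_joint_PiM:
  assumes [measurable_cong]: "sets \<nu> = sets borel"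
  shows "(\<lambda>z. energy_on J (joint B x z)) \<in> borel_measurable (PiM B (\<lambda>_. \<nu>))"
  by (rule borel_measurable_energy_on_joint) measurable

text \<open>
  A union bound over the finitely many candidates \<open>(J, j)\<close> in \<open>may_change\<close>, each of which is compared
  with \<open>shrinks\<close> by resampling the coordinate \<open>j\<close>.
\<close>

lemma change_probability_le_shrink_probability:
  fixes \<nu> :: "real measure" and \<kappa> \<delta> r c d :: real and x :: "'i \<Rightarrow> real"
  assumes \<nu>: "prob_space \<nu>" "sets \<nu> = sets borel"
    and reg: "\<And>a b. a < b \<Longrightarrow> {a<..<b} \<subseteq> {c<..<d} \<Longrightarrow>
      r * measure \<nu> {a<..<b} \<le> measure \<nu> (truncation \<delta> a b)"
    and r: "r > 0" and \<delta>: "0 < \<delta>" "\<delta> < 1" and \<kappa>: "0 < \<kappa>"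
    and fin: "finite A" "finite B" and disj: "A \<inter> B = {}" and card: "card B < card A" "card A \<ge> 2"
    and pos: "energy_on A x > 0"
    and x: "\<And>i. i \<in> A \<Longrightarrow> c + 5 * sqrt (energy_on A x) < x i \<and> x i < d - 5 * sqrt (energy_on A x)"
  defines "Q \<equiv> PiM B (\<lambda>_. \<nu>)"
  shows "emeasure Q {z \<in> space Q. may_change A B \<kappa> (joint B x z)} \<le>
    ennreal (card (Pow (A \<union> B) \<times> B) / r) * emeasure Q {z \<in> space Q. shrinks A B (\<delta>\<^sup>2 * \<kappa>) (joint B x z)}"
proof -
  define G where "G = energy_on A x"
  define S where "S = (\<lambda>(J, j). {z \<in> space Q. card J = card A \<and> j \<in> J \<and>
     energy_on J (joint B x z) \<le> energy_on A (joint B x z) \<and>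
     energy_on (J - {j}) (joint B x z) \<le> (1 - \<kappa>) * energy_on A (joint B x z)})"
  define T where "T = {z \<in> space Q. shrinks A B (\<delta>\<^sup>2 * \<kappa>) (joint B x z)}"
  have meas: "(\<lambda>z. energy_on J (joint B x z)) \<in> borel_measurable Q" for J
    unfolding Q_def by (rule measurable_energy_on_joint_PiM) fact
  have T: "T \<in> sets Q" unfolding T_def by (rule sets_shrinks[OF fin meas])
  have S: "S p \<in> sets Q" if p: "p \<in> Pow (A \<union> B) \<times> B" for p
  proof -
    obtain J j where pJ: "p = (J, j)" "J \<subseteq> A \<union> B" using p by auto
    show ?thesis unfolding S_def pJ prod.case by (rule sets_may_change_part[OF meas pJ(2)])
  qed
  have le: "emeasure Q (S p) \<le> ennreal (1 / r) * emeasure Q T" if p: "p \<in> Pow (A \<union> B) \<times> B" for p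
  proof -
    obtain J j where pJ: "p = (J, j)" "J \<subseteq> A \<union> B" "j \<in> B" using p by auto
    show ?thesis
    proof (cases "card J = card A \<and> j \<in> J")
      case True
      have finJ: "finite J" using pJ fin finite_subset by auto
      \<comment> \<open>There are too few samples to fill the core.\<close>
      have "\<not> J \<subseteq> B"
      proof
        assume "J \<subseteq> B"
        then have "card J \<le> card B" by (rule card_mono[OF fin(2)])
        then show False using True card(1) by linarith
      qed
      then obtain i0 where i0: "i0 \<in> J" "i0 \<notin> B" "i0 \<in> A" using pJ by blast
      have "ennreal r * emeasure Q {z \<in> space Q. energy_on J (joint B x z) \<le> G \<and>
             energy_on (J - {j}) (joint B x z) \<le> (1 - \<kappa>) * G} \<le>
         emeasure Q {z \<in> space Q. energy_on J (joint B x z) \<le> (1 - \<delta>\<^sup>2 * \<kappa>) * G}"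
        unfolding Q_def
      proof (rule resampling_one_coordinate[OF \<nu> reg r \<delta> _ \<kappa> fin(2) finJ _ pJ(3) _ i0(1,2)])
        show "G > 0" "j \<in> J" "card J \<ge> 2" using pos True card(2) by (auto simp: G_def)
        show "c + 5 * sqrt G < x i0" "x i0 < d - 5 * sqrt G" using x[OF i0(3)] by (auto simp: G_def)
      qed
      also have "\<dots> \<le> emeasure Q T"
      proof (rule emeasure_mono[OF _ T], rule subsetI)
        fix z assume "z \<in> {z \<in> space Q. energy_on J (joint B x z) \<le> (1 - \<delta>\<^sup>2 * \<kappa>) * G}"
        then show "z \<in> T"
          unfolding T_def shrinks_def using True pJ(2)
          by (auto simp: energy_on_joint_old[OF disj] G_def intro!: bexI[of _ J])
      qed
      finally have "ennreal r * emeasure Q (S p) \<le> emeasure Q T"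
        using True by (simp add: S_def pJ(1) energy_on_joint_old[OF disj] G_def)
      then have "ennreal (1 / r) * (ennreal r * emeasure Q (S p)) \<le> ennreal (1 / r) * emeasure Q T"
        by (rule mult_left_mono) simp
      then show ?thesis using r by (simp add: mult.assoc[symmetric] ennreal_mult[symmetric])
    next
      case False
      then have "S p = {}" by (auto simp: S_def pJ)
      then show ?thesis by simp
    qed
  qed
  have "{z \<in> space Q. may_change A B \<kappa> (joint B x z)} = (\<Union>p\<in>Pow (A \<union> B) \<times> B. S p)"
    unfolding may_change_def S_def by auto
  also have "emeasure Q \<dots> \<le> (\<Sum>p\<in>Pow (A \<union> B) \<times> B. emeasure Q (S p))"
    using fin S by (intro emeasure_subadditive_finite) auto
  also have "\<dots> \<le> (\<Sum>p\<in>Pow (A \<union> B) \<times> B. ennreal (1 / r) * emeasure Q T)"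
    by (intro sum_mono le)
  also have "\<dots> = ennreal (card (Pow (A \<union> B) \<times> B) / r) * emeasure Q T"
    using r by (simp add: ennreal_mult ennreal_of_nat_eq_real_of_nat divide_inverse mult_ac)
  finally show ?thesis unfolding T_def .
qed

text \<open>
  One sample, with index \<open>j0\<close>, close to a well chosen point of the core is enough.
\<close>

lemma shrink_probability_lower_bound:
  fixes \<nu> :: "real measure" and \<epsilon> p :: real and x :: "'i \<Rightarrow> real"
  assumes \<nu>: "prob_space \<nu>" "sets \<nu> = sets borel"
    and fin: "finite A" "finite B" and disj: "A \<inter> B = {}" and ne: "A \<noteq> {}" "j0 \<in> B"
    and p: "\<And>i. i \<in> A \<Longrightarrow> p \<le> measure \<nu> {x i - \<epsilon><..<x i + \<epsilon>}"
    and \<epsilon>: "\<epsilon> \<le> sqrt (energy_on A x) / (14 * (card A)\<^sup>2)"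
  defines "Q \<equiv> PiM B (\<lambda>_. \<nu>)"
  shows "ennreal p \<le> emeasure Q {z \<in> space Q. shrinks A B (1 / (2 * (card A)\<^sup>2)) (joint B x z)}"
proof -
  interpret \<nu>: prob_space \<nu> by fact
  define X where "X = image_mset x (mset_set A)"
  define \<kappa> where "\<kappa> = 1 / (2 * real ((card A)\<^sup>2))"
  have szX: "size X = card A" by (simp add: X_def)
  have EX: "energy X = energy_on A x" by (simp add: X_def energy_on_def)
  have "X \<noteq> {#}" using ne fin by (simp add: X_def mset_set_empty_iff)
  then obtain y v where yv: "y \<in># X" "v \<in># X"
    and red: "\<And>u. \<bar>u - v\<bar> \<le> sqrt (energy X) / (14 * (size X)\<^sup>2) \<Longrightarrow>
       energy (add_mset u (X - {#y#})) \<le> (1 - 1 / (2 * (size X)\<^sup>2)) * energy X"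
    using resampling_near_opposite_point_reduces_energy by blast
  obtain i l where il: "i \<in> A" "y = x i" "l \<in> A" "v = x l" using yv fin by (auto simp: X_def)
  define J where "J = insert j0 (A - {i})"
  have j0: "j0 \<notin> A" using ne disj by auto
  have "Suc (card (A - {i})) = card A" using il fin by (metis card_Suc_Diff1)
  then have J: "J \<subseteq> A \<union> B" "card J = card A" using fin ne j0 by (auto simp: J_def)
  have EJ: "energy_on J (joint B x z) = energy (add_mset (z j0) (X - {#y#}))" for z
  proof -
    have "X = add_mset y (image_mset x (mset_set (A - {i})))"
      using il fin by (simp add: X_def mset_set.remove)
    moreover have "mset_set J = add_mset j0 (mset_set (A - {i}))"
      using fin j0 by (simp add: J_def)
    moreover have "image_mset (joint B x z) (mset_set (A - {i})) = image_mset x (mset_set (A - {i}))"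
      using fin disj by (intro image_mset_cong) (auto simp: joint_def)
    ultimately show ?thesis using ne by (simp add: energy_on_def joint_def)
  qed
  have T: "{z \<in> space Q. shrinks A B \<kappa> (joint B x z)} \<in> sets Q"
    unfolding Q_def by (intro sets_shrinks measurable_energy_on_joint_PiM fin \<nu>)
  have "ennreal p \<le> emeasure \<nu> {x l - \<epsilon><..<x l + \<epsilon>}"
    using p[OF il(3)] by (simp add: \<nu>.emeasure_eq_measure)
  also have "\<dots> = emeasure (distr Q \<nu> (\<lambda>z. z j0)) {x l - \<epsilon><..<x l + \<epsilon>}"
    unfolding Q_def by (subst distr_PiM_component) (use fin ne \<nu> in auto)
  also have "\<dots> = emeasure Q ((\<lambda>z. z j0) -` {x l - \<epsilon><..<x l + \<epsilon>} \<inter> space Q)"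
    using ne \<nu>(2) unfolding Q_def by (intro emeasure_distr measurable_component_singleton) auto
  also have "\<dots> \<le> emeasure Q {z \<in> space Q. shrinks A B \<kappa> (joint B x z)}"
  proof (rule emeasure_mono[OF _ T], safe)
    fix z assume z: "z j0 \<in> {x l - \<epsilon><..<x l + \<epsilon>}"
    have "energy_on J (joint B x z) \<le> (1 - \<kappa>) * energy_on A x"
      unfolding EJ \<kappa>_def using red[of "z j0"] z \<epsilon> il by (simp add: EX szX abs_le_iff)
    then show "shrinks A B \<kappa> (joint B x z)"
      unfolding shrinks_def using J by (auto simp: energy_on_joint_old[OF disj])
  qed
  finally show ?thesis by (simp add: \<kappa>_def)
qed



section \<open>Order statistics of a configuration\<close>

text \<open>
  The order statistics turn the multiset-valued core into real random variables. The value 0 for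
  indices out of range is arbitrary.
\<close>

definition order_stat :: "nat \<Rightarrow> real multiset \<Rightarrow> real" where
  "order_stat k Y = (if k < size Y then sorted_list_of_multiset Y ! k else 0)"

lemma image_order_stat:
  "image_mset (\<lambda>k. order_stat k Y) (mset_set {..<size Y}) = Y"
proof -
  define xs where "xs = sorted_list_of_multiset Y"
  have Y: "Y = mset xs" by (simp add: xs_def)
  have "size Y = length xs" by (simp add: Y)
  then have "image_mset (\<lambda>k. order_stat k Y) (mset_set {..<size Y}) = image_mset (\<lambda>k. xs ! k) (mset_set {..<length xs})"
    by (auto simp: order_stat_def xs_def[symmetric] intro!: image_mset_cong)
  also have "\<dots> = mset (map ((!) xs) [0..<length xs])"
    by (simp add: lessThan_atLeast0)
  also have "\<dots> = Y" by (simp only: map_nth Y)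
  finally show ?thesis .
qed

lemma nth_le_iff_card_filter:
  fixes xs :: "real list"
  assumes "sorted xs" "k < length xs"
  shows "xs ! k \<le> a \<longleftrightarrow> k < length (filter (\<lambda>x. x \<le> a) xs)"
  using assms
proof (induction xs arbitrary: k)
  case (Cons x xs)
  show ?case
  proof (cases "x \<le> a")
    case True
    then show ?thesis using Cons by (cases k) auto
  next
    case False
    then have gt: "\<forall>y\<in>set (x # xs). \<not> y \<le> a" using Cons.prems by auto
    then have "\<not> (x # xs) ! k \<le> a" using Cons.prems nth_mem by blast
    moreover have "filter (\<lambda>x. x \<le> a) (x # xs) = []" using gt unfolding filter_empty_conv by blast
    ultimately show ?thesis by (simp del: nth_Cons filter.simps)
  qed
qed simp

lemma order_stat_le_iff:
  assumes "k < size Y"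
  shows "order_stat k Y \<le> a \<longleftrightarrow> k < size {#x \<in># Y. x \<in> {..a}#}"
proof -
  define xs where "xs = sorted_list_of_multiset Y"
  have Y: "Y = mset xs" by (simp add: xs_def)
  have "k < length xs" using assms by (simp add: Y)
  moreover have "order_stat k Y = xs ! k" using assms by (simp add: order_stat_def xs_def)
  moreover have "size {#x \<in># Y. x \<in> {..a}#} = length (filter (\<lambda>x. x \<le> a) xs)"
    unfolding Y atMost_iff mset_filter[symmetric] by (rule size_mset)
  ultimately show ?thesis using nth_le_iff_card_filter[of xs k a] by (simp add: xs_def)
qed

text \<open>
  Whether an order statistic is at most \<open>a\<close> is decided by the number of points in \<open>{..a}\<close>, and counting
  points is what generates \<open>config_algebra\<close>.
\<close>

lemma order_stat_measurable: "order_stat k \<in> borel_measurable config_algebra"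
proof (rule borel_measurable_iff_le[THEN iffD2], rule allI)
  fix a :: real
  define F where "F S l = {Y :: real multiset. size {#x \<in># Y. x \<in> S#} = l}" for S l
  have F: "F S l \<in> sets config_algebra" if "S \<in> sets borel" for S l
    using that unfolding config_algebra_def F_def by (intro in_measure_of) auto
  have sp: "space config_algebra = UNIV" by (simp add: config_algebra_def)
  define U where "U = (\<Union>l\<le>k. F UNIV l)"
  define V where "V = (\<Union>l\<le>k. F {..a} l)"
  have [measurable]: "U \<in> sets config_algebra" "V \<in> sets config_algebra"
    using F by (auto simp: U_def V_def)
  have "{Y \<in> space config_algebra. order_stat k Y \<le> a} = (if 0 \<le> a then U else {}) \<union> (space config_algebra - U - V)"
  proof (rule set_eqI)
    fix Y :: "real multiset"
    have "Y \<in> U \<longleftrightarrow> \<not> k < size Y" "Y \<in> V \<longleftrightarrow> \<not> k < size {#x \<in># Y. x \<in> {..a}#}"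
      by (auto simp: U_def V_def F_def)
    then show "Y \<in> {Y \<in> space config_algebra. order_stat k Y \<le> a} \<longleftrightarrow>
      Y \<in> (if 0 \<le> a then U else {}) \<union> (space config_algebra - U - V)"
      using order_stat_le_iff[of k Y a] by (cases "k < size Y") (auto simp: sp order_stat_def)
  qed
  then show "{Y \<in> space config_algebra. order_stat k Y \<le> a} \<in> sets config_algebra" by simp
qed

lemma Min_eq_order_stat:
  assumes "Y \<noteq> {#}"
  shows "Min (set_mset Y) = order_stat 0 Y"
proof -
  define xs where "xs = sorted_list_of_multiset Y"
  have Y: "Y = mset xs" and s: "sorted xs" by (simp_all add: xs_def)
  have "xs \<noteq> []" using assms by (auto simp: Y)
  then have "Min (set xs) = xs ! 0"
    using s by (cases xs) (auto intro!: Min_eqI)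
  then show ?thesis using \<open>xs \<noteq> []\<close> by (simp add: order_stat_def Y flip: xs_def) (simp add: xs_def)
qed


section \<open>The process on indexed families\<close>

lemma (in prob_space) indep_vars_reindex_inj:
  assumes "indep_vars (\<lambda>_. N') Y (f ` I)" "inj_on f I"
  shows "indep_vars (\<lambda>_. N') (\<lambda>i. Y (f i)) I"
proof -
  define F where "F = (\<lambda>k. {Y k -` A \<inter> space M | A. A \<in> sets N'})"
  have rv: "\<And>i. i \<in> I \<Longrightarrow> random_variable N' (Y (f i))" and F: "indep_sets F (f ` I)"
    using assms(1) by (auto simp: indep_vars_def2 F_def)
  have "indep_sets (\<lambda>i. F (f i)) I"
    unfolding indep_sets_def
  proof (intro conjI ballI allI impI)
    fix i assume "i \<in> I"
    then show "F (f i) \<subseteq> events" using F by (auto simp: indep_sets_def)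
  next
    fix J A assume J: "J \<subseteq> I" "J \<noteq> {}" "finite J" and A: "A \<in> Pi J (\<lambda>i. F (f i))"
    have inj: "inj_on f J" using assms(2) J(1) by (rule inj_on_subset)
    define A' where "A' = A \<circ> the_inv_into J f"
    have A': "A' (f j) = A j" if "j \<in> J" for j
      using that inj by (simp add: A'_def the_inv_into_f_f)
    have "A' \<in> Pi (f ` J) F" using A A' by auto
    moreover have "f ` J \<subseteq> f ` I" "f ` J \<noteq> {}" "finite (f ` J)" using J by auto
    ultimately have "prob (\<Inter>k\<in>f ` J. A' k) = (\<Prod>k\<in>f ` J. prob (A' k))"
      using F unfolding indep_sets_def by blast
    then show "prob (\<Inter>j\<in>J. A j) = (\<Prod>j\<in>J. prob (A j))"
      using inj A' by (simp add: prod.reindex)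
  qed
  then show ?thesis using rv by (simp add: indep_vars_def2 F_def)
qed

text \<open>
  The process in which the samples of one step are fewer than the points of the core.
\<close>

locale jante_minority = jante_process M P \<zeta> N K X C Z + P: prob_space P
  for M :: "'w measure" and P :: "'b measure" and \<zeta> :: "'b \<Rightarrow> real" and N K :: nat
    and X C :: "nat \<Rightarrow> 'w \<Rightarrow> real multiset" and Z :: "nat \<Rightarrow> nat \<Rightarrow> 'w \<Rightarrow> real" +
  assumes sample_measurable [measurable]: "\<zeta> \<in> borel_measurable P"
    and K_pos: "K \<ge> 1" and K_minority: "2 * K < N" and N_ge: "N \<ge> 3"
begin

abbreviation "core_idx \<equiv> {K<..N}"
abbreviation "new_idx \<equiv> {1..K}"

definition \<nu> :: "real measure" where "\<nu> = distr P borel \<zeta>"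

text \<open>
  Just before time \<open>t + 1\<close> there are \<open>N\<close> indexed points: the samples \<open>Z (t + 1) j\<close> keep their indices
  \<open>{1..K}\<close>, and the points of the core at time \<open>t\<close>, in increasing order, get the indices \<open>{K<..N}\<close>.
\<close>

definition old :: "nat \<Rightarrow> 'w \<Rightarrow> nat \<Rightarrow> real" where
  "old t \<omega> = (\<lambda>i\<in>core_idx. order_stat (i - Suc K) (C t \<omega>))"

definition new :: "nat \<Rightarrow> 'w \<Rightarrow> nat \<Rightarrow> real" where
  "new t \<omega> = (\<lambda>j\<in>new_idx. Z (Suc t) j \<omega>)"

definition points :: "nat \<Rightarrow> 'w \<Rightarrow> nat \<Rightarrow> real" where
  "points t \<omega> = joint new_idx (old t \<omega>) (new t \<omega>)"

lemma sets_\<nu> [measurable_cong]: "sets \<nu> = sets borel"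
  by (simp add: \<nu>_def)

lemma prob_space_\<nu>: "prob_space \<nu>"
  unfolding \<nu>_def by (rule P.prob_space_distr) simp

lemma idx_facts:
  "finite core_idx" "finite new_idx" "core_idx \<inter> new_idx = {}" "card core_idx = N - K"
  "card new_idx = K" "K < N - K" "2 \<le> N - K"
  using K_pos K_minority N_ge by auto

lemma size_core: "\<omega> \<in> space M \<Longrightarrow> size (C t \<omega>) = N - K"
  using core_minimizes[of \<omega> t] by (simp add: cores_def)

lemma core_eq_old:
  assumes "\<omega> \<in> space M"
  shows "image_mset (old t \<omega>) (mset_set core_idx) = C t \<omega>"
proof -
  have "core_idx = (\<lambda>k. k + Suc K) ` {..<N - K}"
  proof (intro set_eqI iffI)
    fix i assume "i \<in> core_idx"
    then show "i \<in> (\<lambda>k. k + Suc K) ` {..<N - K}" by (intro image_eqI[of _ _ "i - Suc K"]) auto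
  qed auto
  then have "mset_set core_idx = image_mset (\<lambda>k. k + Suc K) (mset_set {..<N - K})"
    by (simp add: image_mset_mset_set inj_on_def)
  then have "image_mset (\<lambda>i. order_stat (i - Suc K) (C t \<omega>)) (mset_set core_idx) =
      image_mset (\<lambda>k. order_stat k (C t \<omega>)) (mset_set {..<N - K})"
    by (simp add: multiset.map_comp comp_def)
  also have "\<dots> = C t \<omega>" using image_order_stat[of "C t \<omega>"] by (simp add: size_core assms)
  finally show ?thesis
    unfolding old_def by (subst image_mset_cong[of _ _ "\<lambda>i. order_stat (i - Suc K) (C t \<omega>)"]) auto
qed

lemma core_eq_points:
  assumes "\<omega> \<in> space M"
  shows "image_mset (points t \<omega>) (mset_set core_idx) = C t \<omega>"
  unfolding core_eq_old[OF assms, symmetric] points_def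
  by (intro image_mset_cong) (auto simp: joint_def)

lemma energy_core: "\<omega> \<in> space M \<Longrightarrow> energy_on core_idx (points t \<omega>) = energy (C t \<omega>)"
  "\<omega> \<in> space M \<Longrightarrow> energy_on core_idx (old t \<omega>) = energy (C t \<omega>)"
  by (simp_all add: energy_on_def core_eq_points core_eq_old)

lemma next_configuration:
  assumes "\<omega> \<in> space M"
  shows "X (Suc t) \<omega> = image_mset (points t \<omega>) (mset_set core_idx) + image_mset (points t \<omega>) (mset_set new_idx)"
proof -
  have "image_mset (points t \<omega>) (mset_set new_idx) = {#Z (Suc t) j \<omega>. j \<in># mset_set new_idx#}"
    by (intro image_mset_cong) (auto simp: points_def joint_def new_def)
  then show ?thesis using step[OF assms] core_eq_points[OF assms] by simp
qed

lemma energy_next_le: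
  assumes \<omega>: "\<omega> \<in> space M" and J: "J \<subseteq> core_idx \<union> new_idx" "card J = N - K"
  shows "energy (C (Suc t) \<omega>) \<le> energy_on J (points t \<omega>)"
proof -
  have "mset_set J \<subseteq># mset_set core_idx + mset_set new_idx"
    using J idx_facts by (simp add: subset_imp_msubset_mset_set flip: mset_set_Union)
  then have "image_mset (points t \<omega>) (mset_set J) \<subseteq># X (Suc t) \<omega>"
    unfolding next_configuration[OF \<omega>] image_mset_union[symmetric] by (rule image_mset_subseteq_mono)
  then show ?thesis
    using core_minimizes[OF \<omega>, of "Suc t"] J by (auto simp: cores_def energy_on_def)
qed

lemma energy_decreasing:
  assumes "\<omega> \<in> space M"
  shows "energy (C (Suc t) \<omega>) \<le> energy (C t \<omega>)"
  using energy_next_le[OF assms, of core_idx t] idx_facts by (simp add: energy_core assms)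

lemma energy_shrinks:
  assumes "\<omega> \<in> space M" "shrinks core_idx new_idx \<kappa> (points t \<omega>)"
  shows "energy (C (Suc t) \<omega>) \<le> (1 - \<kappa>) * energy (C t \<omega>)"
  using assms energy_next_le[OF assms(1), of _ t] idx_facts(4)
  by (auto simp: shrinks_def energy_core intro: order_trans)

lemma core_changed_may_change:
  assumes \<omega>: "\<omega> \<in> space M" and "C (Suc t) \<omega> \<noteq> C t \<omega>" "energy (C t \<omega>) > 0"
  shows "may_change core_idx new_idx (1 / (20 * real (N - K) ^ 4)) (points t \<omega>)"
proof -
  have "C (Suc t) \<omega> \<in> cores (card core_idx) (image_mset (points t \<omega>) (mset_set core_idx) +
      image_mset (points t \<omega>) (mset_set new_idx))"
    using core_minimizes[OF \<omega>, of "Suc t"] by (simp only: next_configuration[OF \<omega>] idx_facts(4))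
  then obtain J j where "J \<subseteq> core_idx \<union> new_idx" "card J = card core_idx" "j \<in> J \<inter> new_idx"
    "energy_on J (points t \<omega>) \<le> energy_on core_idx (points t \<omega>)"
    "energy_on (J - {j}) (points t \<omega>) \<le> (1 - 1 / (20 * real (card core_idx) ^ 4)) * energy_on core_idx (points t \<omega>)"
  proof (rule changed_core_relies_on_new_index[rotated 4])
    show "card new_idx < card core_idx" unfolding idx_facts(4,5) by (rule idx_facts)
  qed (use assms idx_facts in \<open>auto simp only: energy_core core_eq_points\<close>)
  then show ?thesis unfolding may_change_def by (intro bexI[of _ "(J, j)"]) (auto simp: idx_facts(4))
qed

lemma measurable_old [measurable]: "old t \<in> M \<rightarrow>\<^sub>M PiM core_idx (\<lambda>_. borel)"
  unfolding old_def
  by (intro measurable_restrict measurable_compose[OF core_measurable order_stat_measurable])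

lemma measurable_Z: "t \<ge> 1 \<Longrightarrow> j \<in> new_idx \<Longrightarrow> Z t j \<in> borel_measurable M"
  using samples_indep by (auto simp: indep_vars_def)

lemma measurable_new [measurable]: "new t \<in> M \<rightarrow>\<^sub>M PiM new_idx (\<lambda>_. borel)"
  unfolding new_def by (intro measurable_restrict measurable_Z) auto

lemma indep_old_new: "indep_var (PiM core_idx (\<lambda>_. borel)) (old t) (PiM new_idx (\<lambda>_. borel)) (new t)"
  unfolding indep_var_eq
proof (intro conjI measurable_old measurable_new)
  have hsp: "space (history M K (X 0) C Z (Suc t) t) = space M"
    and nsp: "space (noise M K Z (Suc t)) = space M"
    by (simp_all add: history_def noise_def space_measure_of_conv)
  have gen: "C t -` A \<inter> space M \<in> sets (history M K (X 0) C Z (Suc t) t)"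
    if "A \<in> sets config_algebra" for A
    unfolding history_def
  proof (subst sets_measure_of)
    show "C t -` A \<inter> space M \<in> sigma_sets (space M)
     ({X 0 -` A \<inter> space M | A. A \<in> sets config_algebra} \<union>
      {C s -` A \<inter> space M | s A. s < Suc t \<and> A \<in> sets config_algebra} \<union>
      {Z s j -` B \<inter> space M | s j B. s \<in> {1..t} \<and> j \<in> {1..K} \<and> B \<in> sets borel})"
      by (rule sigma_sets.Basic, rule UnI1, rule UnI2) (use that in blast)
  qed auto
  have Ch: "C t \<in> history M K (X 0) C Z (Suc t) t \<rightarrow>\<^sub>M config_algebra"
    by (rule measurableI) (auto simp: hsp gen config_algebra_def)
  have oldh: "old t \<in> history M K (X 0) C Z (Suc t) t \<rightarrow>\<^sub>M PiM core_idx (\<lambda>_. borel)"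
    unfolding old_def by (intro measurable_restrict measurable_compose[OF Ch order_stat_measurable])
  have genZ: "Z (Suc t) j -` A \<inter> space M \<in> sets (noise M K Z (Suc t))"
    if "A \<in> sets borel" "j \<in> new_idx" for A j
    unfolding noise_def by (subst sets_measure_of) (use that in \<open>auto intro!: sigma_sets.Basic\<close>)
  have Zn: "Z (Suc t) j \<in> noise M K Z (Suc t) \<rightarrow>\<^sub>M borel" if "j \<in> new_idx" for j
    by (rule measurableI) (use that in \<open>auto simp: nsp genZ\<close>)
  have newn: "new t \<in> noise M K Z (Suc t) \<rightarrow>\<^sub>M PiM new_idx (\<lambda>_. borel)"
    unfolding new_def by (intro measurable_restrict Zn)
  have 1: "sigma_sets (space M) {old t -` A \<inter> space M |A. A \<in> sets (PiM core_idx (\<lambda>_. borel))}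
      \<subseteq> sets (history M K (X 0) C Z (Suc t) t)"
    using measurable_sets[OF oldh]
    by (subst hsp[symmetric], intro sets.sigma_sets_subset) (auto simp: hsp)
  have 2: "sigma_sets (space M) {new t -` A \<inter> space M |A. A \<in> sets (PiM new_idx (\<lambda>_. borel))}
      \<subseteq> sets (noise M K Z (Suc t))"
    using measurable_sets[OF newn]
    by (subst nsp[symmetric], intro sets.sigma_sets_subset) (auto simp: nsp)
  have "indep_set (sets (history M K (X 0) C Z (Suc t) t)) (sets (noise M K Z (Suc t)))"
    using samples_indep_history[of t] unfolding indep_sets2_eq by (metis Int_commute mult.commute)
  then show "indep_set
     (sigma_sets (space M) {old t -` A \<inter> space M |A. A \<in> sets (PiM core_idx (\<lambda>_. borel))})
     (sigma_sets (space M) {new t -` A \<inter> space M |A. A \<in> sets (PiM new_idx (\<lambda>_. borel))})"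
    using 1 2 unfolding indep_sets2_eq by blast
qed

lemma distr_new: "distr M (PiM new_idx (\<lambda>_. borel)) (new t) = PiM new_idx (\<lambda>_. \<nu>)"
proof -
  have "indep_vars (\<lambda>_. borel) (\<lambda>(t, j). Z t j) ((\<lambda>j. (Suc t, j)) ` new_idx)"
    using samples_indep by (rule indep_vars_subset) auto
  then have "indep_vars (\<lambda>_. borel) (\<lambda>j. Z (Suc t) j) new_idx"
    using indep_vars_reindex_inj[of borel "\<lambda>(t, j). Z t j" "\<lambda>j. (Suc t, j)" new_idx]
    by (auto simp: inj_on_def)
  then have "distr M (PiM new_idx (\<lambda>_. borel)) (\<lambda>\<omega>. \<lambda>j\<in>new_idx. Z (Suc t) j \<omega>) =
      PiM new_idx (\<lambda>j. distr M borel (Z (Suc t) j))"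
    using K_pos by (subst indep_vars_iff_distr_eq_PiM'[symmetric]) (auto intro: measurable_Z)
  also have "\<dots> = PiM new_idx (\<lambda>_. \<nu>)"
    by (intro PiM_cong refl) (simp add: samples_distr \<nu>_def)
  finally show ?thesis unfolding new_def .
qed

text \<open>
  Fubini's theorem for the next samples and the past: expectations may be computed by averaging over
  the samples with the core held fixed.
\<close>

lemma nn_integral_old_new:
  assumes [measurable]: "case_prod F \<in> borel_measurable (PiM core_idx (\<lambda>_. borel) \<Otimes>\<^sub>M PiM new_idx (\<lambda>_. borel))"
  shows "(\<integral>\<^sup>+\<omega>. F (old t \<omega>) (new t \<omega>) \<partial>M) =
    (\<integral>\<^sup>+x. (\<integral>\<^sup>+z. F x z \<partial>PiM new_idx (\<lambda>_. \<nu>)) \<partial>distr M (PiM core_idx (\<lambda>_. borel)) (old t))"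
proof -
  interpret Q: prob_space "PiM new_idx (\<lambda>_. \<nu>)" by (intro prob_space_PiM prob_space_\<nu>)
  have sq [measurable_cong]: "sets (PiM new_idx (\<lambda>_. \<nu>)) = sets (PiM new_idx (\<lambda>_. borel))"
    by (intro sets_PiM_cong refl sets_\<nu>)
  have "(\<integral>\<^sup>+\<omega>. F (old t \<omega>) (new t \<omega>) \<partial>M) = (\<integral>\<^sup>+p. case_prod F p \<partial>distr M
      (PiM core_idx (\<lambda>_. borel) \<Otimes>\<^sub>M PiM new_idx (\<lambda>_. borel)) (\<lambda>\<omega>. (old t \<omega>, new t \<omega>)))"
    using assms measurable_Pair[OF measurable_old[of t] measurable_new[of t]]
    by (subst nn_integral_distr) (simp_all del: One_nat_def)
  also have "distr M (PiM core_idx (\<lambda>_. borel) \<Otimes>\<^sub>M PiM new_idx (\<lambda>_. borel)) (\<lambda>\<omega>. (old t \<omega>, new t \<omega>)) =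
      distr M (PiM core_idx (\<lambda>_. borel)) (old t) \<Otimes>\<^sub>M PiM new_idx (\<lambda>_. \<nu>)"
    using indep_old_new[of t] unfolding indep_var_distribution_eq distr_new by simp
  also have "(\<integral>\<^sup>+p. case_prod F p \<partial>(distr M (PiM core_idx (\<lambda>_. borel)) (old t) \<Otimes>\<^sub>M PiM new_idx (\<lambda>_. \<nu>))) =
    (\<integral>\<^sup>+x. (\<integral>\<^sup>+z. F x z \<partial>PiM new_idx (\<lambda>_. \<nu>)) \<partial>distr M (PiM core_idx (\<lambda>_. borel)) (old t))"
  proof (subst Q.nn_integral_fst[symmetric])
    have "sets (distr M (PiM core_idx (\<lambda>_. borel)) (old t) \<Otimes>\<^sub>M PiM new_idx (\<lambda>_. \<nu>)) =
        sets (PiM core_idx (\<lambda>_. borel) \<Otimes>\<^sub>M PiM new_idx (\<lambda>_. borel))"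
      by (intro sets_pair_measure_cong sq) simp
    then show "case_prod F \<in> borel_measurable (distr M (PiM core_idx (\<lambda>_. borel)) (old t) \<Otimes>\<^sub>M PiM new_idx (\<lambda>_. \<nu>))"
      using assms measurable_cong_sets by blast
  qed simp
  finally show ?thesis .
qed

end


section \<open>Summable moves\<close>

context jante_minority
begin

text \<open>
  Averaging over the samples first replaces the event \<open>Ap\<close> by \<open>shrinks\<close>, at the price of the factor \<open>c\<close>.
  Each time \<open>shrinks\<close> occurs, \<open>sqrt (energy (C t \<omega>))\<close> drops by at least \<open>\<kappa> / 2\<close> times itself. Truncating
  it at \<open>m\<close> does not affect these drops, and makes the sum of all drops at most \<open>m\<close>.
\<close>

lemma summable_weighted_visits:
  fixes Bp Ap :: "(nat \<Rightarrow> real) \<Rightarrow> bool" and m c \<kappa> :: real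
  defines "PA \<equiv> PiM core_idx (\<lambda>_. borel :: real measure)" and "PB \<equiv> PiM new_idx (\<lambda>_. borel :: real measure)"
    and "Q \<equiv> PiM new_idx (\<lambda>_. \<nu>)"
  assumes Bp: "{x \<in> space PA. Bp x} \<in> sets PA"
    and Ap: "{p \<in> space (PA \<Otimes>\<^sub>M PB). Ap (joint new_idx (fst p) (snd p))} \<in> sets (PA \<Otimes>\<^sub>M PB)"
    and bound: "\<And>x. Bp x \<Longrightarrow> sqrt (energy_on core_idx x) \<le> m"
    and prob: "\<And>x. Bp x \<Longrightarrow> 0 < energy_on core_idx x \<Longrightarrow>
      emeasure Q {z \<in> space Q. Ap (joint new_idx x z)} \<le>
      ennreal c * emeasure Q {z \<in> space Q. shrinks core_idx new_idx \<kappa> (joint new_idx x z)}"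
    and \<kappa>: "0 < \<kappa>" "\<kappa> \<le> 1" and c: "0 \<le> c"
  shows "AE \<omega> in M. summable (\<lambda>t. if Bp (old t \<omega>) \<and> Ap (points t \<omega>) then sqrt (energy (C t \<omega>)) else 0)"
proof -
  define B' where "B' = {x \<in> space PA. Bp x}"
  define A' where "A' = {p \<in> space (PA \<Otimes>\<^sub>M PB). Ap (joint new_idx (fst p) (snd p))}"
  define S' where "S' = {p \<in> space (PA \<Otimes>\<^sub>M PB). shrinks core_idx new_idx \<kappa> (joint new_idx (fst p) (snd p))}"
  have [measurable_cong]: "sets PA = sets (PiM core_idx (\<lambda>_. borel :: real measure))"
    "sets PB = sets (PiM new_idx (\<lambda>_. borel :: real measure))" by (simp_all add: PA_def PB_def)
  have meJ: "(\<lambda>p. energy_on J (joint new_idx (fst p) (snd p))) \<in> borel_measurable (PA \<Otimes>\<^sub>M PB)"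
    if "J \<subseteq> core_idx \<union> new_idx" for J
  proof (rule borel_measurable_energy_on_joint)
    show "(\<lambda>p. snd p i) \<in> borel_measurable (PA \<Otimes>\<^sub>M PB)" if "i \<in> new_idx" for i
      using that unfolding PB_def by measurable
    show "(\<lambda>p. fst p i) \<in> borel_measurable (PA \<Otimes>\<^sub>M PB)" if "i \<in> J - new_idx" for i
      unfolding PA_def by (rule measurable_compose[OF measurable_fst measurable_component_singleton])
        (use that \<open>J \<subseteq> _\<close> in auto)
  qed
  have S' [measurable]: "S' \<in> sets (PA \<Otimes>\<^sub>M PB)"
    unfolding S'_def by (rule sets_shrinks[OF idx_facts(1,2) meJ])
  have [measurable]: "A' \<in> sets (PA \<Otimes>\<^sub>M PB)" "B' \<in> sets PA"
    unfolding A'_def B'_def by (rule Ap Bp)+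
  have en [measurable]: "energy_on core_idx \<in> borel_measurable PA"
    unfolding PA_def using borel_measurable_energy_on[of core_idx "\<lambda>i x. x i"] by simp
  define e where "e x = ennreal (sqrt (energy_on core_idx x))" for x
  have e [measurable]: "e \<in> borel_measurable PA"
    unfolding e_def by measurable
  define F where "F E x z = e x * indicator B' x * indicator E (x, z)" for E :: "((nat \<Rightarrow> real) \<times> (nat \<Rightarrow> real)) set" and x z
  have F: "case_prod (F E) \<in> borel_measurable (PA \<Otimes>\<^sub>M PB)" if [measurable]: "E \<in> sets (PA \<Otimes>\<^sub>M PB)" for E
    unfolding F_def case_prod_unfold by measurable
  have sQ: "sets Q = sets PB" unfolding Q_def PB_def by (intro sets_PiM_cong refl sets_\<nu>)
  have spQ: "space Q = space PB" by (rule sets_eq_imp_space_eq[OF sQ])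
  have inner: "(\<integral>\<^sup>+z. F A' x z \<partial>Q) \<le> ennreal c * (\<integral>\<^sup>+z. F S' x z \<partial>Q)" if x: "x \<in> space PA" for x
  proof (cases "Bp x \<and> 0 < energy_on core_idx x")
    case False
    then have "F A' x z = 0" for z
      using energy_on_nonneg[of core_idx x] by (auto simp: F_def B'_def e_def)
    then show ?thesis by simp
  next
    case True
    have sec: "(\<integral>\<^sup>+z. F E x z \<partial>Q) = e x * emeasure Q {z \<in> space Q. (x, z) \<in> E}"
      if [measurable]: "E \<in> sets (PA \<Otimes>\<^sub>M PB)" for E
    proof -
      have "Pair x -` E \<in> sets PB" using that by (rule sets_Pair1)
      then have m: "{z \<in> space Q. (x, z) \<in> E} \<in> sets Q"
        using sets.Int[of "Pair x -` E" Q "space Q"] sets.top[of PB]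
        by (auto simp: sQ spQ vimage_def Int_def conj_commute)
      have "(\<integral>\<^sup>+z. F E x z \<partial>Q) = (\<integral>\<^sup>+z. e x * indicator {z \<in> space Q. (x, z) \<in> E} z \<partial>Q)"
        using True x by (intro nn_integral_cong) (auto simp: F_def B'_def split: split_indicator)
      then show ?thesis using m by (simp add: nn_integral_cmult_indicator)
    qed
    have "{z \<in> space Q. (x, z) \<in> A'} = {z \<in> space Q. Ap (joint new_idx x z)}"
      "{z \<in> space Q. (x, z) \<in> S'} = {z \<in> space Q. shrinks core_idx new_idx \<kappa> (joint new_idx x z)}"
      using x by (auto simp: A'_def S'_def spQ space_pair_measure)
    then have "(\<integral>\<^sup>+z. F A' x z \<partial>Q) \<le> e x * (ennreal c * emeasure Q {z \<in> space Q. (x, z) \<in> S'})"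
      using prob[of x] True by (simp add: sec mult_left_mono)
    also have "\<dots> = ennreal c * (\<integral>\<^sup>+z. F S' x z \<partial>Q)" by (simp add: sec mult_ac)
    finally show ?thesis .
  qed
  have outer: "(\<integral>\<^sup>+\<omega>. F A' (old t \<omega>) (new t \<omega>) \<partial>M) \<le> ennreal c * (\<integral>\<^sup>+\<omega>. F S' (old t \<omega>) (new t \<omega>) \<partial>M)" for t
  proof -
    define D where "D = distr M PA (old t)"
    have FI: "(\<integral>\<^sup>+\<omega>. F E (old t \<omega>) (new t \<omega>) \<partial>M) = (\<integral>\<^sup>+x. (\<integral>\<^sup>+z. F E x z \<partial>Q) \<partial>D)"
      if "E \<in> sets (PA \<Otimes>\<^sub>M PB)" for E
      using nn_integral_old_new[of "F E" t] F[OF that] unfolding PA_def PB_def Q_def D_def by simp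
    interpret Q: prob_space Q unfolding Q_def by (intro prob_space_PiM prob_space_\<nu>)
    have "case_prod (F S') \<in> borel_measurable (D \<Otimes>\<^sub>M Q)"
    proof -
      have "sets (D \<Otimes>\<^sub>M Q) = sets (PA \<Otimes>\<^sub>M PB)" by (intro sets_pair_measure_cong sQ) (simp add: D_def)
      then show ?thesis using F[OF S'] measurable_cong_sets by blast
    qed
    then have mF: "(\<lambda>x. \<integral>\<^sup>+z. F S' x z \<partial>Q) \<in> borel_measurable D" by (rule Q.borel_measurable_nn_integral)
    have "(\<integral>\<^sup>+\<omega>. F A' (old t \<omega>) (new t \<omega>) \<partial>M) \<le> (\<integral>\<^sup>+x. ennreal c * (\<integral>\<^sup>+z. F S' x z \<partial>Q) \<partial>D)"
      unfolding FI[OF \<open>A' \<in> _\<close>] by (intro nn_integral_mono inner) (simp add: D_def)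
    also have "\<dots> = ennreal c * (\<integral>\<^sup>+\<omega>. F S' (old t \<omega>) (new t \<omega>) \<partial>M)"
      unfolding FI[OF S'] by (rule nn_integral_cmult[OF mF])
    finally show ?thesis .
  qed
  \<comment> \<open>\<open>energy (X 0)\<close> need not be integrable; the truncation makes the telescoping sum bounded.\<close>
  define \<psi> where "\<psi> t \<omega> = min m (sqrt (energy_on core_idx (old t \<omega>)))" for t \<omega>
  have mo: "old t \<in> M \<rightarrow>\<^sub>M PA" "new t \<in> M \<rightarrow>\<^sub>M PB" for t
    unfolding PA_def PB_def by (rule measurable_old measurable_new)+
  have \<psi>m [measurable]: "\<psi> t \<in> borel_measurable M" for t
  proof -
    have [measurable]: "(\<lambda>\<omega>. energy_on core_idx (old t \<omega>)) \<in> borel_measurable M"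
      by (rule measurable_compose[OF mo(1) en])
    show ?thesis unfolding \<psi>_def by measurable
  qed
  have \<psi>dec: "\<psi> (Suc t) \<omega> \<le> \<psi> t \<omega>" if "\<omega> \<in> space M" for t \<omega>
    using energy_decreasing[OF that, of t] unfolding \<psi>_def energy_core(2)[OF that]
    by (intro min.mono) auto
  have sp: "(old t \<omega>, new t \<omega>) \<in> space (PA \<Otimes>\<^sub>M PB)" if "\<omega> \<in> space M" for t \<omega>
    using that measurable_space[OF mo(1)] measurable_space[OF mo(2)] by (auto simp: space_pair_measure)
  have drop: "F S' (old t \<omega>) (new t \<omega>) \<le> ennreal (2 / \<kappa>) * ennreal (\<psi> t \<omega> - \<psi> (Suc t) \<omega>)"
    if \<omega>: "\<omega> \<in> space M" for t \<omega>
  proof (cases "Bp (old t \<omega>) \<and> shrinks core_idx new_idx \<kappa> (points t \<omega>)")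
    case False
    then have "F S' (old t \<omega>) (new t \<omega>) = 0" by (auto simp: F_def B'_def S'_def points_def)
    then show ?thesis by simp
  next
    case True
    define q where "q = sqrt (energy (C t \<omega>))"
    have q: "q \<ge> 0" "q \<le> m" "\<psi> t \<omega> = q"
      using bound[of "old t \<omega>"] True by (simp_all add: q_def energy_nonneg energy_core(2)[OF \<omega>] \<psi>_def min_def)
    have "energy (C (Suc t) \<omega>) \<le> (1 - \<kappa>) * energy (C t \<omega>)"
      using True by (intro energy_shrinks \<omega>) simp
    also have "\<dots> = (1 - \<kappa>) * q\<^sup>2" by (simp add: q_def energy_nonneg)
    also have "\<dots> \<le> ((1 - \<kappa> / 2) * q)\<^sup>2"
    proof -
      have "1 - \<kappa> \<le> (1 - \<kappa> / 2)\<^sup>2" by (simp add: power2_eq_square algebra_simps)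
      then show ?thesis unfolding power_mult_distrib by (rule mult_right_mono) simp
    qed
    finally have "sqrt (energy (C (Suc t) \<omega>)) \<le> (1 - \<kappa> / 2) * q"
      using \<kappa> q by (intro real_le_lsqrt) auto
    then have "\<psi> (Suc t) \<omega> \<le> (1 - \<kappa> / 2) * q"
      unfolding \<psi>_def energy_core(2)[OF \<omega>] by (rule min.coboundedI2)
    then have "q \<le> 2 / \<kappa> * (\<psi> t \<omega> - \<psi> (Suc t) \<omega>)" using \<kappa> q by (simp add: field_simps)
    moreover have "F S' (old t \<omega>) (new t \<omega>) = ennreal q"
      using True sp[OF \<omega>, of t] by (simp add: F_def B'_def S'_def points_def e_def q_def energy_core(2)[OF \<omega>] space_pair_measure)
    ultimately show ?thesis
      using \<kappa> \<psi>dec[OF \<omega>, of t] by (simp add: ennreal_mult[symmetric] ennreal_leI)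
  qed
  have m0: "m \<ge> 0 \<or> (\<forall>x. \<not> Bp x)"
    using bound order_trans[OF real_sqrt_ge_zero[OF energy_on_nonneg]] by blast
  show ?thesis
  proof (cases "m \<ge> 0")
    case False
    then have "\<not> Bp x" for x using m0 by blast
    then show ?thesis by simp
  next
    case m: True
    define g where "g t \<omega> = F A' (old t \<omega>) (new t \<omega>)" for t \<omega>
    have gm [measurable]: "g t \<in> borel_measurable M" for t
      unfolding g_def using measurable_compose[OF measurable_Pair[OF mo] F[OF \<open>A' \<in> _\<close>]] by simp
    have "(\<Sum>t<T. \<integral>\<^sup>+\<omega>. g t \<omega> \<partial>M) \<le> ennreal c * (ennreal (2 / \<kappa>) * ennreal m)" for T
    proof -
      have "(\<Sum>t<T. \<integral>\<^sup>+\<omega>. g t \<omega> \<partial>M) \<le> (\<Sum>t<T. ennreal c * (\<integral>\<^sup>+\<omega>. ennreal (2 / \<kappa>) * ennreal (\<psi> t \<omega> - \<psi> (Suc t) \<omega>) \<partial>M))"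
        unfolding g_def
        by (intro sum_mono order_trans[OF outer] mult_left_mono nn_integral_mono drop) auto
      also have "\<dots> = ennreal c * (ennreal (2 / \<kappa>) * (\<integral>\<^sup>+\<omega>. (\<Sum>t<T. ennreal (\<psi> t \<omega> - \<psi> (Suc t) \<omega>)) \<partial>M))"
        by (simp add: nn_integral_sum nn_integral_cmult sum_distrib_left mult.assoc)
      also have "\<dots> \<le> ennreal c * (ennreal (2 / \<kappa>) * (\<integral>\<^sup>+\<omega>. ennreal m \<partial>M))"
      proof (intro mult_left_mono nn_integral_mono)
        fix \<omega> assume \<omega>: "\<omega> \<in> space M"
        have "(\<Sum>t<T. ennreal (\<psi> t \<omega> - \<psi> (Suc t) \<omega>)) = ennreal (\<Sum>t<T. \<psi> t \<omega> - \<psi> (Suc t) \<omega>)"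
          using \<psi>dec[OF \<omega>] by (intro sum_ennreal) simp
        also have "(\<Sum>t<T. \<psi> t \<omega> - \<psi> (Suc t) \<omega>) = \<psi> 0 \<omega> - \<psi> T \<omega>" by (rule sum_lessThan_telescope')
        also have "\<dots> \<le> m"
        proof -
          have "\<psi> 0 \<omega> \<le> m" "0 \<le> \<psi> T \<omega>" using m by (simp_all add: \<psi>_def energy_on_nonneg)
          then show ?thesis by linarith
        qed
        finally show "(\<Sum>t<T. ennreal (\<psi> t \<omega> - \<psi> (Suc t) \<omega>)) \<le> ennreal m" by (simp add: ennreal_leI)
      qed auto
      also have "\<dots> = ennreal c * (ennreal (2 / \<kappa>) * ennreal m)" by (simp add: emeasure_space_1)
      finally show ?thesis .
    qed
    then have "(\<Sum>t. \<integral>\<^sup>+\<omega>. g t \<omega> \<partial>M) \<le> ennreal c * (ennreal (2 / \<kappa>) * ennreal m)"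
      by (intro suminf_le_const) auto
    then have "(\<integral>\<^sup>+\<omega>. (\<Sum>t. g t \<omega>) \<partial>M) \<noteq> \<infinity>"
      by (subst nn_integral_suminf) (auto simp: ennreal_mult[symmetric] c \<kappa>(1) less_imp_le m top_unique)
    then have "AE \<omega> in M. (\<Sum>t. g t \<omega>) \<noteq> \<infinity>" by (intro nn_integral_noteq_infinite) auto
    then show ?thesis
    proof (rule AE_mp, intro AE_I2 impI)
      fix \<omega> assume \<omega>: "\<omega> \<in> space M" and fin: "(\<Sum>t. g t \<omega>) \<noteq> \<infinity>"
      have "g t \<omega> = ennreal (if Bp (old t \<omega>) \<and> Ap (points t \<omega>) then sqrt (energy (C t \<omega>)) else 0)" for t
        using sp[OF \<omega>, of t]
        by (auto simp: g_def F_def B'_def A'_def points_def e_def energy_core(2)[OF \<omega>] space_pair_measure)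
      then show "summable (\<lambda>t. if Bp (old t \<omega>) \<and> Ap (points t \<omega>) then sqrt (energy (C t \<omega>)) else 0)"
        using fin by (intro summable_suminf_not_top) (auto simp: energy_nonneg)
    qed
  qed
qed

end


section \<open>From summable moves to convergence\<close>

text \<open>
  A sequence with steps at most \<open>l\<close> cannot jump over a strip of width \<open>l\<close>.
\<close>

lemma oscillation_visits_strip:
  fixes u :: "nat \<Rightarrow> real"
  assumes step: "\<And>t. \<bar>u (Suc t) - u t\<bar> \<le> l"
    and low: "\<exists>\<^sub>F t in sequentially. u t < a" and high: "\<exists>\<^sub>F t in sequentially. a < u t"
  shows "\<exists>\<^sub>F t in sequentially. a \<le> u t \<and> u t \<le> a + l"
proof (rule ccontr)
  assume "\<not> ?thesis"
  then have "\<forall>\<^sub>F t in sequentially. \<not> (a \<le> u t \<and> u t \<le> a + l)" by (simp add: not_frequently)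
  then obtain T where T: "\<And>t. t \<ge> T \<Longrightarrow> \<not> (a \<le> u t \<and> u t \<le> a + l)"
    by (auto simp: eventually_sequentially)
  obtain t1 where t1: "t1 \<ge> T" "u t1 < a" using low by (auto simp: frequently_sequentially)
  have "u t < a" if "t \<ge> t1" for t
    using that
  proof (induction t rule: dec_induct)
    case (step t)
    have "u (Suc t) \<le> a + l" using assms(1)[of t] step.IH by linarith
    then show ?case using T[of "Suc t"] t1 step.hyps by auto
  qed (use t1 in simp)
  moreover obtain t2 where "t2 \<ge> t1" "a < u t2" using high by (auto simp: frequently_sequentially)
  ultimately show False by (metis not_less_iff_gr_or_eq)
qed

text \<open>
  The hypothesis \<open>visits\<close> says that a core which returns to a bounded set infinitely often becomes
  arbitrarily narrow, and \<open>barrier\<close> that between any two levels the core travels a finite distance in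
  total within some interval. Countably many instances of each suffice, so both may be assumed
  simultaneously for almost every path. The limit is that of the smallest point of the core.
\<close>

lemma cores_converge:
  fixes Y :: "nat \<Rightarrow> real multiset"
  assumes ne: "\<And>t. Y t \<noteq> {#}"
    and dec: "\<And>t. energy (Y (Suc t)) \<le> energy (Y t)"
    and common: "\<And>t. \<exists>x. x \<in># Y t \<and> x \<in># Y (Suc t)"
    and visits: "\<And>m::nat. \<forall>\<^sub>F t in sequentially.
      \<not> (1 / (real m + 1) \<le> energy (Y t) \<and> (\<forall>x\<in>#Y t. \<bar>x\<bar> \<le> real m))"
    and barrier: "\<And>a b. a \<in> \<rat> \<Longrightarrow> b \<in> \<rat> \<Longrightarrow> a < b \<Longrightarrow> \<exists>c d. a \<le> c \<and> c < d \<and> d \<le> b \<and>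
      summable (\<lambda>t. if (\<forall>x\<in>#Y t. c + 5 * sqrt (energy (Y t)) < x \<and> x < d - 5 * sqrt (energy (Y t))) \<and>
        Y (Suc t) \<noteq> Y t then sqrt (energy (Y t)) else 0)"
  shows "tends_to Y (liminf (\<lambda>t. ereal (Min (set_mset (Y t)))))"
proof -
  define u where "u t = Min (set_mset (Y t))" for t
  define D where "D t = sqrt (energy (Y t))" for t
  have D0: "D t \<ge> 0" for t by (simp add: D_def energy_nonneg)
  have Ddec: "D t \<le> D s" if "s \<le> t" for s t
    using that by (rule lift_Suc_antimono_le[rotated]) (simp add: D_def dec)
  have uin: "u t \<in># Y t" for t
    unfolding u_def using ne[of t] by (intro Min_in) auto
  have between: "u t \<le> x" "x \<le> u t + 3 / 2 * D t" if "x \<in># Y t" for x t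
    using that distance_le_sqrt_energy[OF that uin[of t]] by (auto simp: u_def D_def)
  have ustep: "\<bar>u (Suc t) - u t\<bar> \<le> 3 * D t" for t
  proof -
    obtain x where "x \<in># Y t" "x \<in># Y (Suc t)" using common by blast
    then show ?thesis using between[of x t] between[of x "Suc t"] Ddec[of t "Suc t"] D0[of t] by linarith
  qed
  have D_small: "\<forall>\<^sub>F t in sequentially. D t < \<epsilon>"
    if freq: "\<exists>\<^sub>F t in sequentially. \<bar>u t\<bar> \<le> R" and \<epsilon>: "\<epsilon> > 0" for R \<epsilon>
  proof -
    obtain m1 :: nat where m1: "R + 3 / 2 * D 0 \<le> real m1" using real_arch_simple by blast
    obtain m2 :: nat where m2: "1 / \<epsilon>\<^sup>2 < real m2" using reals_Archimedean2 by blast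
    define m where "m = max m1 m2"
    have "1 / \<epsilon>\<^sup>2 < real m + 1" using m2 by (simp add: m_def)
    then have m: "1 / (real m + 1) < \<epsilon>\<^sup>2" using \<epsilon> by (simp add: field_simps)
    from frequently_ex[OF frequently_eventually_frequently[OF freq visits[of m]]]
    obtain t where t: "\<bar>u t\<bar> \<le> R" "\<not> (1 / (real m + 1) \<le> energy (Y t) \<and> (\<forall>x\<in>#Y t. \<bar>x\<bar> \<le> real m))"
      by blast
    have "\<bar>x\<bar> \<le> real m" if "x \<in># Y t" for x
    proof -
      have "\<bar>x\<bar> \<le> R + 3 / 2 * D 0" using between[OF that] t(1) Ddec[of 0 t] by linarith
      then show ?thesis using m1 by (simp add: m_def)
    qed
    then have "energy (Y t) < 1 / (real m + 1)" using t(2) by auto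
    then have "D t < sqrt (\<epsilon>\<^sup>2)" using m unfolding D_def by (intro real_sqrt_less_mono) linarith
    then have "D t < \<epsilon>" using \<epsilon> by simp
    then show ?thesis
      unfolding eventually_sequentially using Ddec by (metis order_le_less_trans)
  qed
  define \<phi> where "\<phi> = liminf (\<lambda>t. ereal (u t))"
  have "\<phi> = limsup (\<lambda>t. ereal (u t))"
  proof (rule ccontr)
    assume "\<phi> \<noteq> limsup (\<lambda>t. ereal (u t))"
    then have "\<phi> < limsup (\<lambda>t. ereal (u t))"
      using Liminf_le_Limsup[of sequentially "\<lambda>t. ereal (u t)"] by (simp add: \<phi>_def)
    then obtain a' b' where ab': "\<phi> < ereal a'" "a' < b'" "ereal b' < limsup (\<lambda>t. ereal (u t))"
      by (metis ereal_dense2 less_ereal.simps(1))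
    obtain a where a: "a \<in> \<rat>" "a' < a" "a < b'" using Rats_dense_in_real[OF ab'(2)] by blast
    obtain b where b: "b \<in> \<rat>" "a < b" "b < b'" using Rats_dense_in_real[OF a(3)] by blast
    have low: "\<exists>\<^sub>F t in sequentially. u t < a"
    proof (rule ccontr)
      assume "\<not> ?thesis"
      then have "\<forall>\<^sub>F t in sequentially. ereal a \<le> ereal (u t)" by (simp add: not_frequently not_less)
      then have "ereal a \<le> \<phi>" unfolding \<phi>_def by (rule Liminf_bounded)
      then show False using ab'(1) a(2) by (metis less_ereal.simps(1) not_less order_less_trans)
    qed
    have high: "\<exists>\<^sub>F t in sequentially. b < u t"
    proof (rule ccontr)
      assume "\<not> ?thesis"
      then have "\<forall>\<^sub>F t in sequentially. ereal (u t) \<le> ereal b" by (simp add: not_frequently not_less)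
      then have "limsup (\<lambda>t. ereal (u t)) \<le> ereal b" by (rule Limsup_bounded)
      then show False using ab'(3) b(3) by (metis less_ereal.simps(1) not_less order_less_trans)
    qed
    have "\<exists>\<^sub>F t in sequentially. a \<le> u t \<and> u t \<le> a + 3 * D 0"
    proof (rule oscillation_visits_strip[OF _ low])
      show "\<bar>u (Suc t) - u t\<bar> \<le> 3 * D 0" for t using ustep[of t] Ddec[of 0 t] by simp
      show "\<exists>\<^sub>F t in sequentially. a < u t" using high by (rule frequently_elim1) (use b in simp)
    qed
    then have visited: "\<exists>\<^sub>F t in sequentially. \<bar>u t\<bar> \<le> \<bar>a\<bar> + 3 * D 0"
      by (rule frequently_elim1) (use D0[of 0] in linarith)
    obtain c d where cd: "a \<le> c" "c < d" "d \<le> b" and sm: "summable (\<lambda>t.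
        if (\<forall>x\<in>#Y t. c + 5 * D t < x \<and> x < d - 5 * D t) \<and> Y (Suc t) \<noteq> Y t then D t else 0)"
      using barrier[OF a(1) b(1,2)] unfolding D_def by blast
    define s where "s t = (if (\<forall>x\<in>#Y t. c + 5 * D t < x \<and> x < d - 5 * D t) \<and> Y (Suc t) \<noteq> Y t then D t else 0)" for t
    define h where "h = (d - c) / 10"
    have h: "h > 0" "d = c + 10 * h" using cd by (simp_all add: h_def field_simps)
    have s0: "s t \<ge> 0" for t by (simp add: s_def D0)
    \<comment> \<open>The position clipped to the inner part of \<open>(c, d)\<close>. Once steps are shorter than \<open>h\<close>, it only
      changes at times when the whole core is well inside.\<close>
    define v where "v t = max (c + 2 * h) (min (d - 2 * h) (u t))" for t
    have "\<forall>\<^sub>F t in sequentially. D t < h / 10" by (rule D_small[OF visited]) (use h in simp)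
    then have vstep: "\<forall>\<^sub>F t in sequentially. norm (v (Suc t) - v t) \<le> 3 * s t"
    proof (rule eventually_mono)
      fix t assume Dt: "D t < h / 10"
      show "norm (v (Suc t) - v t) \<le> 3 * s t"
      proof (cases "Y (Suc t) = Y t")
        case True
        then show ?thesis using s0[of t] by (simp add: v_def u_def)
      next
        case changed: False
        consider "u t < c + h" | "c + h \<le> u t" "u t \<le> d - h" | "d - h < u t" by linarith
        then show ?thesis
        proof cases
          case 1
          then have "v (Suc t) = v t" using ustep[of t] Dt h unfolding v_def by linarith
          then show ?thesis using s0[of t] by simp
        next
          case 2
          have "c + 5 * D t < x \<and> x < d - 5 * D t" if "x \<in># Y t" for x
            using between[OF that] 2 Dt h by linarith
          then have "s t = D t" using changed by (simp add: s_def)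
          moreover have "\<bar>v (Suc t) - v t\<bar> \<le> \<bar>u (Suc t) - u t\<bar>" unfolding v_def by linarith
          ultimately show ?thesis using ustep[of t] by simp
        next
          case 3
          then have "v (Suc t) = v t" using ustep[of t] Dt h unfolding v_def by linarith
          then show ?thesis using s0[of t] by simp
        qed
      qed
    qed
    have "summable (\<lambda>t. 3 * s t)" using sm unfolding s_def[symmetric] by (rule summable_mult)
    then have "summable (\<lambda>t. v (Suc t) - v t)" using vstep by (rule summable_comparison_test_ev[rotated])
    then have "convergent (\<lambda>n. \<Sum>t<n. v (Suc t) - v t)" by (simp add: summable_iff_convergent)
    then obtain l where "(\<lambda>n. v n - v 0) \<longlonglongrightarrow> l" by (auto simp: convergent_def sum_lessThan_telescope)
    then have "\<forall>\<^sub>F t in sequentially. dist (v t - v 0) l < h" by (rule tendstoD) (use h in simp)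
    then obtain T where T: "\<And>t. t \<ge> T \<Longrightarrow> \<bar>v t - v 0 - l\<bar> < h"
      by (auto simp: eventually_sequentially dist_real_def)
    obtain t1 where t1: "t1 \<ge> T" "u t1 < a" using low by (auto simp: frequently_sequentially)
    obtain t2 where t2: "t2 \<ge> T" "b < u t2" using high by (auto simp: frequently_sequentially)
    have "v t1 = c + 2 * h" "v t2 = d - 2 * h" using t1 t2 cd h unfolding v_def by linarith+
    then show False using T[OF t1(1)] T[OF t2(1)] h by linarith
  qed
  then have lim: "(\<lambda>t. ereal (u t)) \<longlonglongrightarrow> \<phi>"
    unfolding \<phi>_def by (intro Liminf_eq_Limsup) auto
  have "tends_to Y \<phi>"
  proof (cases \<phi>)
    case (real r)
    then have ur: "u \<longlonglongrightarrow> r" using lim by simp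
    then have "\<forall>\<^sub>F t in sequentially. dist (u t) r < 1" by (rule tendstoD) simp
    then have "\<forall>\<^sub>F t in sequentially. \<bar>u t\<bar> \<le> \<bar>r\<bar> + 1"
      by (rule eventually_mono) (unfold dist_real_def, linarith)
    then have vis: "\<exists>\<^sub>F t in sequentially. \<bar>u t\<bar> \<le> \<bar>r\<bar> + 1" by (rule eventually_frequently[rotated]) simp
    have "\<forall>\<^sub>F t in sequentially. \<forall>x\<in>#Y t. \<bar>x - r\<bar> < \<epsilon>" if "\<epsilon> > 0" for \<epsilon>
    proof -
      have "\<forall>\<^sub>F t in sequentially. dist (u t) r < \<epsilon> / 4" by (rule tendstoD[OF ur]) (use that in simp)
      moreover have "\<forall>\<^sub>F t in sequentially. D t < \<epsilon> / 4" by (rule D_small[OF vis]) (use that in simp)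
      ultimately show ?thesis
      proof eventually_elim
        case (elim t)
        show ?case
        proof
          fix x assume "x \<in># Y t"
          then show "\<bar>x - r\<bar> < \<epsilon>" using between[of x t] elim that unfolding dist_real_def by linarith
        qed
      qed
    qed
    then show ?thesis by (simp add: tends_to_def real)
  next
    case PInf
    then have "filterlim u at_top sequentially" using lim by (simp add: tendsto_PInfty_eq_at_top)
    then show ?thesis unfolding tends_to_def PInf infinity_ereal_def ereal.case u_def .
  next
    case MInf
    have "filterlim (\<lambda>t. Max (set_mset (Y t))) at_bot sequentially"
      unfolding filterlim_at_bot
    proof
      fix z
      have "\<forall>\<^sub>F t in sequentially. ereal (u t) < ereal (z - 3 / 2 * D 0)"
        using lim unfolding MInf by (auto simp: tendsto_MInfty)
      then show "\<forall>\<^sub>F t in sequentially. Max (set_mset (Y t)) \<le> z"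
      proof (rule eventually_mono)
        fix t assume t: "ereal (u t) < ereal (z - 3 / 2 * D 0)"
        have "x \<le> z" if "x \<in># Y t" for x using between[OF that] t Ddec[of 0 t] by simp
        then show "Max (set_mset (Y t)) \<le> z" using ne[of t] by simp
      qed
    qed
    then show ?thesis unfolding tends_to_def MInf MInfty_eq_minfinity[symmetric] ereal.case .
  qed
  then show ?thesis by (simp add: \<phi>_def u_def)
qed


section \<open>Almost sure convergence of the core\<close>

context jante_minority
begin

lemma measure_\<nu>: "S \<in> sets borel \<Longrightarrow> measure \<nu> S = \<P>(\<omega> in P. \<zeta> \<omega> \<in> S)"
  unfolding \<nu>_def by (simp add: measure_distr vimage_def Int_def conj_commute)

lemma all_core_iff:
  assumes "\<omega> \<in> space M"
  shows "(\<forall>x\<in>#C t \<omega>. R x) \<longleftrightarrow> (\<forall>i\<in>core_idx. R (old t \<omega> i))"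
  unfolding core_eq_old[OF assms, of t, symmetric] by simp

text \<open>
  Covers both sets of cores used below: a bounded box with a lower bound on the energy (\<open>l = 0\<close>) and
  the cores far inside an interval compared with their own diameter (\<open>l = 5\<close>).
\<close>

lemma sets_energy_box:
  assumes "open U"
  shows "{x \<in> space (PiM core_idx (\<lambda>_. borel)). L \<le> energy_on core_idx x \<and>
      (\<forall>i\<in>core_idx. c + l * sqrt (energy_on core_idx x) < x i \<and> x i < d - l * sqrt (energy_on core_idx x) \<and> x i \<in> U)}
    \<in> sets (PiM core_idx (\<lambda>_. borel :: real measure))"
proof -
  have [measurable]: "energy_on core_idx \<in> borel_measurable (PiM core_idx (\<lambda>_. borel))"
    using borel_measurable_energy_on[of core_idx "\<lambda>i x. x i"] by simp
  have [measurable]: "U \<in> sets borel" using assms by simp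
  have [measurable]: "(\<lambda>x. x i) \<in> PiM core_idx (\<lambda>_. borel :: real measure) \<rightarrow>\<^sub>M borel" if "i \<in> core_idx" for i
    using that by measurable
  show ?thesis
    by (intro sets.sets_Collect_conj sets.sets_Collect_finite_All idx_facts(1)) measurable
qed

text \<open>
  This replaces the statement that all points lie in the support of \<open>\<zeta>\<close>.
\<close>

lemma never_in_null_interval:
  assumes null: "measure \<nu> {a<..<b} = 0"
  shows "AE \<omega> in M. \<forall>t. \<forall>x\<in>#C t \<omega>. x \<notin> {a<..<b}"
proof -
  interpret \<nu>: prob_space \<nu> by (rule prob_space_\<nu>)
  have "AE \<omega> in M. Z t j \<omega> \<notin> {a<..<b}" if tj: "t \<ge> 1" "j \<in> new_idx" for t j
  proof -
    have "AE x in \<nu>. x \<notin> {a<..<b}"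
      using null by (intro AE_not_in) (auto simp: null_sets_def \<nu>.emeasure_eq_measure)
    then have "AE x in distr M borel (Z t j). x \<notin> {a<..<b}"
      unfolding samples_distr[OF tj] \<nu>_def .
    then show ?thesis by (subst (asm) AE_distr_iff) (auto intro: measurable_Z tj)
  qed
  then have "AE \<omega> in M. \<forall>t\<in>{1..}. \<forall>j\<in>new_idx. Z t j \<omega> \<notin> {a<..<b}"
    by (intro AE_ball_countable') auto
  then show ?thesis
  proof (rule AE_mp, intro AE_I2 impI)
    fix \<omega> assume \<omega>: "\<omega> \<in> space M" and Z: "\<forall>t\<in>{1..}. \<forall>j\<in>new_idx. Z t j \<omega> \<notin> {a<..<b}"
    have CX: "set_mset (C t \<omega>) \<subseteq> set_mset (X t \<omega>)" for t
      using core_minimizes[OF \<omega>, of t] by (auto simp: cores_def dest: mset_subset_eqD)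
    have "\<forall>x\<in>#X t \<omega>. x \<notin> {a<..<b}" for t
    proof (induction t)
      case 0
      show ?case
      proof (intro ballI notI)
        fix x assume x: "x \<in># X 0 \<omega>" "x \<in> {a<..<b}"
        define \<epsilon> where "\<epsilon> = min (x - a) (b - x)"
        have "\<epsilon> > 0" using x by (simp add: \<epsilon>_def)
        then have "0 < \<P>(\<omega> in P. \<bar>\<zeta> \<omega> - x\<bar> < \<epsilon>)"
          using initial_support[OF \<omega>] x(1) by (auto simp: rv_support_def)
        also have "\<dots> \<le> \<P>(\<omega> in P. \<zeta> \<omega> \<in> {a<..<b})"
          by (intro P.finite_measure_mono) (auto simp: \<epsilon>_def abs_less_iff)
        finally show False using null by (simp add: measure_\<nu>)
      qed
    next
      case (Suc t)
      then show ?case using Z CX[of t] by (auto simp: step[OF \<omega>])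
    qed
    then show "\<forall>t. \<forall>x\<in>#C t \<omega>. x \<notin> {a<..<b}" using CX by blast
  qed
qed

text \<open>
  Cover the line by open grid intervals \<open>W k\<close> with mesh \<open>\<eta>\<close> proportional to \<open>sqrt g\<close>. Almost surely no
  point of the process is in a null grid interval, and finitely many of the other ones meet \<open>[-R, R]\<close>.
  So the probabilities of sampling close to a given core point have a common lower bound \<open>p\<close>, and the
  energy shrinks with probability at least \<open>p\<close> at every visit.
\<close>

lemma wide_cores_leave_bounded_sets:
  assumes g: "g > 0" and R: "R \<ge> 0"
  shows "AE \<omega> in M. \<forall>\<^sub>F t in sequentially. \<not> (g \<le> energy (C t \<omega>) \<and> (\<forall>x\<in>#C t \<omega>. \<bar>x\<bar> \<le> R))"
proof -
  interpret \<nu>: prob_space \<nu> by (rule prob_space_\<nu>)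
  interpret Q: prob_space "PiM new_idx (\<lambda>_. \<nu>)" by (intro prob_space_PiM prob_space_\<nu>)
  define n where "n = N - K"
  have n: "n \<ge> 2" using idx_facts by (simp add: n_def)
  \<comment> \<open>Intervals of length \<open>2 * \<eta>\<close> around a core point fit into the tolerance for \<open>u\<close> in
    \<open>resampling_near_opposite_point_reduces_energy\<close>.\<close>
  define \<eta> where "\<eta> = sqrt g / (28 * (real n)\<^sup>2)"
  have \<eta>: "\<eta> > 0" using g n by (simp add: \<eta>_def)
  define W where "W k = {(of_int k - 1) * \<eta><..<(of_int k + 1) * \<eta>}" for k :: int
  define I where "I = {k \<in> {- \<lceil>R / \<eta>\<rceil>..\<lceil>R / \<eta>\<rceil>}. measure \<nu> (W k) > 0}"
  have finI: "finite I" unfolding I_def by (rule finite_subset[of _ "{- \<lceil>R / \<eta>\<rceil>..\<lceil>R / \<eta>\<rceil>}"]) auto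
  define p where "p = Min (insert 1 ((\<lambda>k. measure \<nu> (W k)) ` I))"
  have "p \<in> insert 1 ((\<lambda>k. measure \<nu> (W k)) ` I)" unfolding p_def using finI by (intro Min_in) auto
  then have p: "p > 0" by (auto simp: I_def)
  have pW: "p \<le> measure \<nu> (W k)" if "k \<in> I" for k
    unfolding p_def using finI that by (intro Min_le) auto
  define V where "V = (\<Union>k\<in>I. W k)"
  have V: "open V" by (auto simp: V_def W_def)
  define Bp where "Bp x \<longleftrightarrow> g \<le> energy_on core_idx x \<and> (\<forall>i\<in>core_idx. - (R + 1) < x i \<and> x i < R + 1 \<and> x i \<in> V)"
    for x :: "nat \<Rightarrow> real"
  define m where "m = sqrt (n * (R + 1)\<^sup>2)"
  have "AE \<omega> in M. summable (\<lambda>t. if Bp (old t \<omega>) \<and> True then sqrt (energy (C t \<omega>)) else 0)"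
  proof (rule summable_weighted_visits[where m = m and c = "1 / p" and \<kappa> = "1 / (2 * (real n)\<^sup>2)" and Ap = "\<lambda>_. True"])
    show "{x \<in> space (PiM core_idx (\<lambda>_. borel)). Bp x} \<in> sets (PiM core_idx (\<lambda>_. borel))"
      using sets_energy_box[OF V, of g "- (R + 1)" 0 "R + 1"]
      unfolding Bp_def mult_zero_left add_0_right diff_zero .
    show "sqrt (energy_on core_idx x) \<le> m" if "Bp x" for x
    proof -
      have "energy_on core_idx x \<le> (\<Sum>v\<in>#image_mset x (mset_set core_idx). (v - 0)\<^sup>2)"
        unfolding energy_on_def by (rule energy_le_sum_squares)
      also have "\<dots> \<le> real (size (image_mset x (mset_set core_idx))) * (R + 1)\<^sup>2"
      proof (rule sum_mset_image_le_card)
        fix v assume "v \<in># image_mset x (mset_set core_idx)"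
        then obtain i where i: "i \<in> core_idx" "v = x i" by auto
        have "- (R + 1) < x i \<and> x i < R + 1" using that i(1) unfolding Bp_def by blast
        then have "\<bar>v\<bar> \<le> \<bar>R + 1\<bar>" using i(2) by linarith
        then show "(v - 0)\<^sup>2 \<le> (R + 1)\<^sup>2" by (simp add: abs_le_square_iff)
      qed
      finally show ?thesis by (simp add: m_def n_def)
    qed
    show "emeasure (PiM new_idx (\<lambda>_. \<nu>)) {z \<in> space (PiM new_idx (\<lambda>_. \<nu>)). True} \<le>
      ennreal (1 / p) * emeasure (PiM new_idx (\<lambda>_. \<nu>)) {z \<in> space (PiM new_idx (\<lambda>_. \<nu>)).
        shrinks core_idx new_idx (1 / (2 * (real n)\<^sup>2)) (joint new_idx x z)}" if x: "Bp x" for x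
    proof -
      have "ennreal p \<le> emeasure (PiM new_idx (\<lambda>_. \<nu>)) {z \<in> space (PiM new_idx (\<lambda>_. \<nu>)).
        shrinks core_idx new_idx (1 / (2 * (card core_idx)\<^sup>2)) (joint new_idx x z)}"
      proof (rule shrink_probability_lower_bound[OF prob_space_\<nu> sets_\<nu> idx_facts(1-3), where ?j0.0 = 1 and \<epsilon> = "2 * \<eta>"])
        show "core_idx \<noteq> {}" "1 \<in> new_idx" using K_pos K_minority by auto
        show "p \<le> measure \<nu> {x i - 2 * \<eta><..<x i + 2 * \<eta>}" if "i \<in> core_idx" for i
        proof -
          have "x i \<in> V" using x that unfolding Bp_def by blast
          then obtain k where k: "k \<in> I" "x i \<in> W k" unfolding V_def by blast
          have "W k \<subseteq> {x i - 2 * \<eta><..<x i + 2 * \<eta>}" using k(2) by (auto simp: W_def algebra_simps)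
          then have "measure \<nu> (W k) \<le> measure \<nu> {x i - 2 * \<eta><..<x i + 2 * \<eta>}"
            by (intro \<nu>.finite_measure_mono) (auto simp: sets_\<nu>)
          then show ?thesis using pW[OF k(1)] by simp
        qed
        have "sqrt g \<le> sqrt (energy_on core_idx x)" using x by (simp add: Bp_def)
        then have "sqrt g / (14 * (real n)\<^sup>2) \<le> sqrt (energy_on core_idx x) / (14 * (real n)\<^sup>2)"
          by (rule divide_right_mono) simp
        then show "2 * \<eta> \<le> sqrt (energy_on core_idx x) / real (14 * (card core_idx)\<^sup>2)"
          by (simp add: \<eta>_def idx_facts(4) n_def[symmetric])
      qed
      then have "ennreal (1 / p) * ennreal p \<le> ennreal (1 / p) * emeasure (PiM new_idx (\<lambda>_. \<nu>))
        {z \<in> space (PiM new_idx (\<lambda>_. \<nu>)). shrinks core_idx new_idx (1 / (2 * (card core_idx)\<^sup>2)) (joint new_idx x z)}"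
        by (rule mult_left_mono) simp
      then show ?thesis
        using p by (simp add: ennreal_mult[symmetric] Q.emeasure_space_1 idx_facts(4) n_def[symmetric] del: One_nat_def)
    qed
    have "(real n)\<^sup>2 \<ge> 1" using n by (intro one_le_power) simp
    then have "2 * (real n)\<^sup>2 \<ge> 1" by linarith
    then show "0 < 1 / (2 * (real n)\<^sup>2)" "1 / (2 * (real n)\<^sup>2) \<le> 1" "0 \<le> 1 / p"
      using n p by (auto simp: divide_le_eq_1)
  qed auto
  moreover have "AE \<omega> in M. \<forall>k. measure \<nu> (W k) = 0 \<longrightarrow> (\<forall>t. \<forall>x\<in>#C t \<omega>. x \<notin> W k)"
    unfolding AE_all_countable W_def by (intro allI AE_impI never_in_null_interval)
  ultimately show ?thesis
    using AE_space
  proof eventually_elim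
    case (elim \<omega>)
    have "\<forall>\<^sub>F t in sequentially. (if Bp (old t \<omega>) \<and> True then sqrt (energy (C t \<omega>)) else 0) < sqrt g"
      using elim(1) g by (intro order_tendstoD(2)[OF summable_LIMSEQ_zero]) auto
    then show ?case
    proof (rule eventually_mono, intro notI)
      fix t assume small: "(if Bp (old t \<omega>) \<and> True then sqrt (energy (C t \<omega>)) else 0) < sqrt g"
        and wide: "g \<le> energy (C t \<omega>) \<and> (\<forall>x\<in>#C t \<omega>. \<bar>x\<bar> \<le> R)"
      have "- (R + 1) < x \<and> x < R + 1 \<and> x \<in> V" if x: "x \<in># C t \<omega>" for x
      proof -
        define k where "k = \<lfloor>x / \<eta>\<rfloor>"
        have xR: "\<bar>x\<bar> \<le> R" using wide x by blast
        have "of_int k \<le> x / \<eta>" "x / \<eta> < of_int k + 1" by (simp_all add: k_def)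
        then have k: "of_int k * \<eta> \<le> x" "x < (of_int k + 1) * \<eta>" using \<eta> by (simp_all add: field_simps)
        then have xW: "x \<in> W k" using \<eta> by (simp add: W_def algebra_simps)
        have "- (R / \<eta>) \<le> x / \<eta>" "x / \<eta> \<le> R / \<eta>" using xR \<eta> by (auto simp: field_simps abs_le_iff)
        then have "- \<lceil>R / \<eta>\<rceil> \<le> k" "k \<le> \<lceil>R / \<eta>\<rceil>" unfolding k_def by linarith+
        moreover have "measure \<nu> (W k) \<noteq> 0" using elim(2) x xW by blast
        then have "measure \<nu> (W k) > 0" by (simp add: zero_less_measure_iff)
        ultimately have "k \<in> I" by (simp add: I_def)
        then show ?thesis using xW xR by (auto simp: V_def)
      qed
      then have "\<forall>i\<in>core_idx. - (R + 1) < old t \<omega> i \<and> old t \<omega> i < R + 1 \<and> old t \<omega> i \<in> V"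
        using all_core_iff[OF elim(3), of t "\<lambda>x. - (R + 1) < x \<and> x < R + 1 \<and> x \<in> V"] by blast
      then have "Bp (old t \<omega>)" using wide by (simp add: Bp_def energy_core(2)[OF elim(3)])
      then have "sqrt (energy (C t \<omega>)) < sqrt g" using small by simp
      then show False using wide by simp
    qed
  qed
qed

text \<open>
  The division-free form of the inequality is meaningful on null intervals as well, where it is trivial.
\<close>

lemma regular_interval_measure:
  assumes "regular_interval P \<zeta> c d"
  obtains \<delta> r where "0 < \<delta>" "\<delta> < 1" "0 < r"
    "\<And>a b. a < b \<Longrightarrow> {a<..<b} \<subseteq> {c<..<d} \<Longrightarrow> r * measure \<nu> {a<..<b} \<le> measure \<nu> (truncation \<delta> a b)"
proof -
  obtain \<delta> r where \<delta>: "\<delta> \<in> {0<..<1}" and r: "r \<in> {0<..<1}" and reg: "\<And>a b. a < b \<Longrightarrow> {a<..<b} \<subseteq> {c<..<d} \<Longrightarrow>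
      \<P>(\<omega> in P. \<zeta> \<omega> \<in> {a<..<b}) > 0 \<Longrightarrow>
        \<P>(\<omega> in P. \<zeta> \<omega> \<in> truncation \<delta> a b \<bar> \<zeta> \<omega> \<in> {a<..<b}) \<ge> r"
    using assms by (auto simp: regular_interval_def)
  have "r * measure \<nu> {a<..<b} \<le> measure \<nu> (truncation \<delta> a b)"
    if ab: "a < b" "{a<..<b} \<subseteq> {c<..<d}" for a b
  proof (cases "measure \<nu> {a<..<b} > 0")
    case True
    have "truncation \<delta> a b \<subseteq> {a<..<b}"
    proof
      fix y assume y: "y \<in> truncation \<delta> a b"
      have "\<delta> / 2 * (b - a) > 0" using \<delta> ab by simp
      then show "y \<in> {a<..<b}" using y by (auto simp: truncation_def)
    qed
    then have "{\<omega> \<in> space P. \<zeta> \<omega> \<in> truncation \<delta> a b \<and> \<zeta> \<omega> \<in> {a<..<b}} =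
      {\<omega> \<in> space P. \<zeta> \<omega> \<in> truncation \<delta> a b}" by auto
    moreover have "truncation \<delta> a b \<in> sets borel" by (simp add: truncation_def)
    ultimately have "r \<le> measure \<nu> (truncation \<delta> a b) / measure \<nu> {a<..<b}"
      using reg[OF ab] True by (simp add: cond_prob_def measure_\<nu>)
    then show ?thesis using True by (simp add: le_divide_eq)
  next
    case False
    then have "measure \<nu> {a<..<b} = 0" by (simp add: zero_less_measure_iff)
    then show ?thesis by simp
  qed
  then show thesis using that \<delta> r by auto
qed

text \<open>
  Each summand bounds, up to a constant factor, the distance by which the core moves at time \<open>t\<close> while
  it is well inside the regular interval.
\<close>

lemma summable_moves_in_regular_interval:
  assumes "regular_interval P \<zeta> c d"
  shows "AE \<omega> in M. summable (\<lambda>t. if (\<forall>x\<in>#C t \<omega>. c + 5 * sqrt (energy (C t \<omega>)) < x \<and>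
    x < d - 5 * sqrt (energy (C t \<omega>))) \<and> C (Suc t) \<omega> \<noteq> C t \<omega> then sqrt (energy (C t \<omega>)) else 0)"
proof -
  obtain \<delta> r where \<delta>: "0 < \<delta>" "\<delta> < 1" and r: "0 < r" and reg: "\<And>a b. a < b \<Longrightarrow>
      {a<..<b} \<subseteq> {c<..<d} \<Longrightarrow> r * measure \<nu> {a<..<b} \<le> measure \<nu> (truncation \<delta> a b)"
    using regular_interval_measure[OF assms] by metis
  define \<kappa> where "\<kappa> = 1 / (20 * real (N - K) ^ 4)"
  have "real (N - K) ^ 4 \<ge> 1" using idx_facts(7) by (intro one_le_power) simp
  then have \<kappa>: "0 < \<kappa>" "\<kappa> \<le> 1" unfolding \<kappa>_def by (simp_all only: divide_le_eq_1 zero_less_divide_iff) auto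
  define Bp where "Bp x \<longleftrightarrow> (\<forall>i\<in>core_idx. c + 5 * sqrt (energy_on core_idx x) < x i \<and>
    x i < d - 5 * sqrt (energy_on core_idx x))" for x :: "nat \<Rightarrow> real"
  have "AE \<omega> in M. summable (\<lambda>t. if Bp (old t \<omega>) \<and> may_change core_idx new_idx \<kappa> (points t \<omega>)
    then sqrt (energy (C t \<omega>)) else 0)"
  proof (rule summable_weighted_visits[where m = "d - c" and \<kappa> = "\<delta>\<^sup>2 * \<kappa>" and
        c = "card (Pow (core_idx \<union> new_idx) \<times> new_idx) / r"])
    show "{x \<in> space (PiM core_idx (\<lambda>_. borel)). Bp x} \<in> sets (PiM core_idx (\<lambda>_. borel))"
      using sets_energy_box[of UNIV 0 c 5 d] by (simp add: Bp_def energy_on_nonneg)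
    let ?PP = "PiM core_idx (\<lambda>_. borel :: real measure) \<Otimes>\<^sub>M PiM new_idx (\<lambda>_. borel :: real measure)"
    show "{p \<in> space ?PP. may_change core_idx new_idx \<kappa> (joint new_idx (fst p) (snd p))} \<in> sets ?PP"
    proof (rule sets_may_change[OF idx_facts(1,2)], rule borel_measurable_energy_on_joint)
      fix J i assume J: "J \<subseteq> core_idx \<union> new_idx"
      show "(\<lambda>p. snd p i) \<in> borel_measurable ?PP" if "i \<in> new_idx"
        using that by measurable
      show "(\<lambda>p. fst p i) \<in> borel_measurable ?PP" if "i \<in> J - new_idx"
        by (rule measurable_compose[OF measurable_fst measurable_component_singleton]) (use that J in auto)
    qed
    show "sqrt (energy_on core_idx x) \<le> d - c" if "Bp x" for x
    proof -
      have "N \<in> core_idx" using K_minority by auto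
      then have "c + 5 * sqrt (energy_on core_idx x) < d - 5 * sqrt (energy_on core_idx x)"
        using that by (force simp: Bp_def)
      then show ?thesis using real_sqrt_ge_zero[OF energy_on_nonneg[of core_idx x]] by linarith
    qed
    show "emeasure (PiM new_idx (\<lambda>_. \<nu>)) {z \<in> space (PiM new_idx (\<lambda>_. \<nu>)). may_change core_idx new_idx \<kappa> (joint new_idx x z)} \<le>
      ennreal (card (Pow (core_idx \<union> new_idx) \<times> new_idx) / r) * emeasure (PiM new_idx (\<lambda>_. \<nu>))
        {z \<in> space (PiM new_idx (\<lambda>_. \<nu>)). shrinks core_idx new_idx (\<delta>\<^sup>2 * \<kappa>) (joint new_idx x z)}"
      if "Bp x" "0 < energy_on core_idx x" for x
    proof (rule change_probability_le_shrink_probability[OF prob_space_\<nu> sets_\<nu> reg r \<delta> \<kappa>(1) idx_facts(1-3)])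
      show "card new_idx < card core_idx" "2 \<le> card core_idx" unfolding idx_facts(4,5) by (rule idx_facts)+
    qed (use that in \<open>auto simp: Bp_def\<close>)
    show "0 < \<delta>\<^sup>2 * \<kappa>" "0 \<le> card (Pow (core_idx \<union> new_idx) \<times> new_idx) / r" using \<delta> \<kappa> r by auto
    show "\<delta>\<^sup>2 * \<kappa> \<le> 1" using \<delta> \<kappa> by (intro mult_le_one) (auto simp: power_le_one)
  qed
  then show ?thesis
  proof (rule AE_mp, intro AE_I2 impI)
    fix \<omega> assume \<omega>: "\<omega> \<in> space M"
    assume "summable (\<lambda>t. if Bp (old t \<omega>) \<and> may_change core_idx new_idx \<kappa> (points t \<omega>)
      then sqrt (energy (C t \<omega>)) else 0)"
    then show "summable (\<lambda>t. if (\<forall>x\<in>#C t \<omega>. c + 5 * sqrt (energy (C t \<omega>)) < x \<and>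
      x < d - 5 * sqrt (energy (C t \<omega>))) \<and> C (Suc t) \<omega> \<noteq> C t \<omega> then sqrt (energy (C t \<omega>)) else 0)"
    proof (rule summable_comparison_test'[where N = 0])
      fix t
      show "norm (if (\<forall>x\<in>#C t \<omega>. c + 5 * sqrt (energy (C t \<omega>)) < x \<and>
        x < d - 5 * sqrt (energy (C t \<omega>))) \<and> C (Suc t) \<omega> \<noteq> C t \<omega> then sqrt (energy (C t \<omega>)) else 0) \<le>
        (if Bp (old t \<omega>) \<and> may_change core_idx new_idx \<kappa> (points t \<omega>) then sqrt (energy (C t \<omega>)) else 0)"
        using core_changed_may_change[OF \<omega>, of t] energy_nonneg[of "C t \<omega>"]
        unfolding all_core_iff[OF \<omega>] Bp_def energy_core(2)[OF \<omega>] \<kappa>_def[symmetric]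
        by (auto simp: order_le_less)
    qed
  qed
qed

lemma consecutive_cores_meet:
  assumes "\<omega> \<in> space M"
  shows "\<exists>x. x \<in># C t \<omega> \<and> x \<in># C (Suc t) \<omega>"
proof (rule ccontr)
  assume no: "\<not> ?thesis"
  have "C (Suc t) \<omega> \<subseteq># C t \<omega> + image_mset (\<lambda>j. Z (Suc t) j \<omega>) (mset_set new_idx)"
    using core_minimizes[OF assms, of "Suc t"] step[OF assms, of t] by (simp add: cores_def)
  moreover have "C (Suc t) \<omega> \<inter># C t \<omega> = {#}"
    using no by (auto simp: disjunct_not_in)
  ultimately have "C (Suc t) \<omega> \<subseteq># image_mset (\<lambda>j. Z (Suc t) j \<omega>) (mset_set new_idx)"
    by (metis diff_intersect_left_idem diff_zero inter_mset_def subset_eq_diff_conv add.commute)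
  from size_mset_mono[OF this] show False using idx_facts(6) by (simp add: size_core[OF assms])
qed

text \<open>
  Every interval contains a regular one: by hypothesis if it has positive probability, and trivially
  otherwise, since an interval of probability 0 is itself regular.
\<close>

theorem cores_converge_almost_surely:
  assumes regular: "\<And>a b. a < b \<Longrightarrow> \<P>(\<omega> in P. \<zeta> \<omega> \<in> {a<..<b}) > 0 \<Longrightarrow>
           \<exists>c d. {c<..<d} \<subseteq> {a<..<b} \<and> regular_interval P \<zeta> c d"
  shows "\<exists>\<phi> \<in> borel_measurable M. AE \<omega> in M. tends_to (\<lambda>t. C t \<omega>) (\<phi> \<omega> :: ereal)"
proof
  have ex: "\<exists>c d. a \<le> c \<and> c < d \<and> d \<le> b \<and> regular_interval P \<zeta> c d" if "a < b" for a b
  proof (cases "\<P>(\<omega> in P. \<zeta> \<omega> \<in> {a<..<b}) > 0")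
    case True
    then obtain c d where cd: "{c<..<d} \<subseteq> {a<..<b}" "regular_interval P \<zeta> c d"
      using regular[OF \<open>a < b\<close>] by blast
    then have "c < d" by (simp add: regular_interval_def)
    then show ?thesis using cd by (auto simp: greaterThanLessThan_subseteq_greaterThanLessThan)
  next
    case False
    have "\<not> 0 < \<P>(\<omega> in P. \<zeta> \<omega> \<in> {a'<..<b'})" if "{a'<..<b'} \<subseteq> {a<..<b}" for a' b'
    proof -
      have "\<P>(\<omega> in P. \<zeta> \<omega> \<in> {a'<..<b'}) \<le> \<P>(\<omega> in P. \<zeta> \<omega> \<in> {a<..<b})"
        using that by (intro P.finite_measure_mono) auto
      then show ?thesis using False by linarith
    qed
    then have "regular_interval P \<zeta> a b"
      using \<open>a < b\<close> unfolding regular_interval_def by (auto intro!: exI[of _ "1/2"])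
    then show ?thesis using \<open>a < b\<close> by blast
  qed
  then obtain c d where cd: "\<And>a b. a < b \<Longrightarrow> a \<le> c a b \<and> c a b < d a b \<and> d a b \<le> b \<and> regular_interval P \<zeta> (c a b) (d a b)"
    by metis
  have barrier: "AE \<omega> in M. \<forall>a\<in>\<rat>. \<forall>b\<in>\<rat>. a < b \<longrightarrow> summable (\<lambda>t. if (\<forall>x\<in>#C t \<omega>.
      c a b + 5 * sqrt (energy (C t \<omega>)) < x \<and> x < d a b - 5 * sqrt (energy (C t \<omega>))) \<and>
      C (Suc t) \<omega> \<noteq> C t \<omega> then sqrt (energy (C t \<omega>)) else 0)"
    by (intro AE_ball_countable' countable_rat AE_impI summable_moves_in_regular_interval) (use cd in blast)
  have visits: "AE \<omega> in M. \<forall>m::nat. \<forall>\<^sub>F t in sequentially.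
      \<not> (1 / (real m + 1) \<le> energy (C t \<omega>) \<and> (\<forall>x\<in>#C t \<omega>. \<bar>x\<bar> \<le> real m))"
    unfolding AE_all_countable by (intro allI wide_cores_leave_bounded_sets) auto
  show "AE \<omega> in M. tends_to (\<lambda>t. C t \<omega>) (liminf (\<lambda>t. ereal (order_stat 0 (C t \<omega>))))"
    using barrier visits AE_space
  proof eventually_elim
    case (elim \<omega>)
    have ne: "C t \<omega> \<noteq> {#}" for t using size_core[OF elim(3), of t] idx_facts(7) by auto
    have "tends_to (\<lambda>t. C t \<omega>) (liminf (\<lambda>t. ereal (Min (set_mset (C t \<omega>)))))"
    proof (rule cores_converge)
      fix a b :: real assume "a \<in> \<rat>" "b \<in> \<rat>" "a < b"
      then show "\<exists>c d. a \<le> c \<and> c < d \<and> d \<le> b \<and> summable (\<lambda>t. if (\<forall>x\<in>#C t \<omega>.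
        c + 5 * sqrt (energy (C t \<omega>)) < x \<and> x < d - 5 * sqrt (energy (C t \<omega>))) \<and>
        C (Suc t) \<omega> \<noteq> C t \<omega> then sqrt (energy (C t \<omega>)) else 0)"
        using cd[of a b] elim(1) by blast
    qed (use ne elim energy_decreasing consecutive_cores_meet in auto)
    then show ?case using ne by (simp add: Min_eq_order_stat)
  qed
  show "(\<lambda>\<omega>. liminf (\<lambda>t. ereal (order_stat 0 (C t \<omega>)))) \<in> borel_measurable M"
    by (intro borel_measurable_liminf borel_measurable_ereal
        measurable_compose[OF core_measurable order_stat_measurable])
qed

end

theorem theorem4:
  fixes M :: "'w measure" and P :: "'b measure" and \<zeta> :: "'b \<Rightarrow> real" and N K :: nat
    and X C :: "nat \<Rightarrow> 'w \<Rightarrow> real multiset" and Z :: "nat \<Rightarrow> nat \<Rightarrow> 'w \<Rightarrow> real"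
  assumes "N \<ge> 3" and "K \<ge> 1" and "2 * K < N"
    and "prob_space P" and "\<zeta> \<in> borel_measurable P"
    and "\<And>a b. a < b \<Longrightarrow> \<P>(\<omega> in P. \<zeta> \<omega> \<in> {a<..<b}) > 0 \<Longrightarrow>
           \<exists>c d. {c<..<d} \<subseteq> {a<..<b} \<and> regular_interval P \<zeta> c d"
    and "jante_process M P \<zeta> N K X C Z"
  shows "\<exists>\<phi> \<in> borel_measurable M. AE \<omega> in M. tends_to (\<lambda>t. C t \<omega>) (\<phi> \<omega> :: ereal)"
proof -
  interpret jante_minority M P \<zeta> N K X C Z
    using assms by (simp add: jante_minority_def jante_minority_axioms_def)
  show ?thesis by (rule cores_converge_almost_surely) (rule assms(6))
qed

end
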